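(* Let $n\ge 1$ be an integer and $\tau\in\mathbb{C}$, $\tau\neq 0$. Let $\mathcal{C}_{n,2}$, the path algebra $A$ with its element $c$, the group $\operatorname{PTAut}(A;c)$ acting on $\mathcal{C}_{n,2}$, and the group $\Gamma^{\mathrm{alg}}$ be as defined in the context. Let $\mathcal{F}\in\operatorname{PTAut}(A;c)$ be the class of the automorphism of $A$ given by $$\mathcal{F}(a,a^{*},x,x^{*},y,y^{*})=(-a^{*},a,-y^{*},y,-x^{*},x),$$ i.e. $a\mapsto -a^*$, $a^*\mapsto a$, $x\mapsto -y^*$, $x^*\mapsto y$, $y\mapsto -x^*$, $y^*\mapsto x$. Let $\mathcal{R}_{n,2}\subset\mathcal{C}_{n,2}$ be the Zariski open subset consisting of (classes of) quadruples $(X,Y,v,w)$ such that either $X$ or $Y$ is regular semisimple (i.e. diagonalizable with distinct eigenvalues). Then there exists a morphism of groups $i\colon\Gamma^{\mathrm{alg}}\to\operatorname{PTAut}(A;c)$ such that, if $\mathcal{P}$ denotes the subgroup of $\operatorname{PTAut}(A;c)$ generated by the image of $i$ and $\mathcal{F}$, then for every pair of points $\xi_1,\xi_2\in\mathcal{R}_{n,2}$ there exists an element of $\mathcal{P}$ which maps $\xi_1$ to $\xi_2$.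
   Context: **The variety $\mathcal{C}_{n,2}$.** Let $V_{n,2}=\operatorname{Mat}_{n,n}(\mathbb{C})\oplus\operatorname{Mat}_{n,n}(\mathbb{C})\oplus\operatorname{Mat}_{n,2}(\mathbb{C})\oplus\operatorname{Mat}_{2,n}(\mathbb{C})$, with elements $(X,Y,v,w)$. The group $\operatorname{GL}_n(\mathbb{C})$ acts by $g.(X,Y,v,w)=(gXg^{-1},gYg^{-1},gv,wg^{-1})$. Put $\mu(X,Y,v,w)=[X,Y]+vw$. For fixed $\tau\ne0$ the action on $\mu^{-1}(\tau I)$ is free, and $\mathcal{C}_{n,2}:=\mu^{-1}(\tau I)/\operatorname{GL}_n(\mathbb{C})$. **The algebra $A$.** Consider the quiver with two vertices $1,2$ and arrows $a\colon 1\to1$, $x\colon 2\to 1$, $y\colon 1\to 2$. Its double is obtained by adding, for each arrow, one in the opposite direction: $a^*\colon1\to1$, $x^*\colon 1\to2$, $y^*\colon 2\to1$. $A$ is the complex path algebra of this double quiver, an algebra over $\mathbb{C}^2=\mathbb{C}e_1\oplus\mathbb{C}e_2$, where $e_1,e_2$ are the trivial paths at the vertices. Paths are composed from right to left, so that e.g. $xy$ is a loop at vertex $1$. Automorphisms of $A$ are over $\mathbb{C}^2$ (they fix $e_1,e_2$). Put $c=[a,a^*]+[x,x^*]+[y,y^*]$, and let $\operatorname{Aut}(A;c)$ be the group of automorphisms of $A$ fixing $c$ (symplectic automorphisms). **Tame automorphisms.** An automorphism of $A$ is *strictly triangular* if it fixes $a$, $x$ and $y$. An *affine symplectic automorphism*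 is an element of $\operatorname{Aut}(A;c)$ that acts as an affine transformation of the linear span of $a,a^*,x,x^*,y,y^*$. These are specified by pairs $(B,T)$, where $B\in\mathbb{C}^2\rtimes\operatorname{SL}_2(\mathbb{C})$ acts as a unimodular affine transformation on the span of $a,a^*$, and $T\in\operatorname{GL}_2(\mathbb{C})$ acts by $$\begin{pmatrix} -x \\ {y^*} \end{pmatrix}\mapsto T\begin{pmatrix} -x \\ {y^*} \end{pmatrix},\qquad \begin{pmatrix}x^*&y\end{pmatrix}\mapsto\begin{pmatrix}x^*&y\end{pmatrix}T^{-1}.$$ $\operatorname{TAut}(A;c)$ is the subgroup of $\operatorname{Aut}(A;c)$ generated by the strictly triangular symplectic automorphisms and the affine symplectic automorphisms. Let $Z$ be the subgroup of affine symplectic automorphisms of the form $(I,\lambda I)$, with $I$ the identity of $\mathbb{C}^2\rtimes \operatorname{SL}_2(\mathbb{C})$ and $\lambda\in\mathbb{C}^*$. Define $\operatorname{PTAut}(A;c):=\operatorname{TAut}(A;c)/Z$. **The action on $\mathcal{C}_{n,2}$.** Representations of the double quiver with dimension vector $(n,1)$ are tuples $p=(A_0,B_0,X_1,X_2,Y_1,Y_2)$ of matrices representing respectively $a,a^*,x,y^*,y,x^*$ (two $n\times n$, two $n\times1$, two $1\times n$ matrices). They are identified with points of $V_{n,2}$ via $A_0=X$, $B_0=Y$, $X_1=v_{\bullet1}$, $X_2=-v_{\bullet2}$, $Y_1=w_{2\bullet}$, $Y_2=w_{1\bullet}$, where $v_{\bullet i}$ is the $i$-th column of $v$ and $w_{j\bullet}$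 the $j$-th row of $w$. An automorphism $\varphi$ of $A$ sends $p$ to $$(\varphi(a)(p),\varphi(a^* )(p),\varphi(x)(p),\varphi(y^* )(p),\varphi(y)(p),\varphi(x^* )(p)),$$ where $\varphi(r)(p)$ denotes evaluation of the noncommutative polynomial $\varphi(r)$ at the matrices in $p$. For $\varphi\in\operatorname{TAut}(A;c)$ this induces a map of $\mathcal{C}_{n,2}$ to itself. $Z$ acts trivially on $\mathcal{C}_{n,2}$, so $\operatorname{PTAut}(A;c)$ acts on $\mathcal{C}_{n,2}$. **The group $\Gamma^{\mathrm{alg}}$.** $\Gamma^{\mathrm{alg}}:=\Gamma^{\mathrm{alg}}_{\mathrm{sc}}\times\operatorname{PGL}_2(\mathbb{C}[z])$, where $\Gamma^{\mathrm{alg}}_{\mathrm{sc}}$ is the group (under pointwise multiplication) of maps $\mathbb{C}\to\operatorname{GL}_2(\mathbb{C})$ of the form $e^{p}I_2$ with $p\in\mathbb{C}[z]$ a polynomial with no constant term, and $\operatorname{PGL}_2(\mathbb{C}[z])=\operatorname{GL}_2(\mathbb{C}[z])/\mathbb{C}^*$. *)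

theory Defs
  imports
    "HOL-Analysis.Analysis"
    "HOL-Algebra.Elementary_Groups"
    "HOL-Computational_Algebra.Polynomial"
begin

section \<open>The double quiver and its path algebra\<close>

datatype vertex = V1 | V2

(* The suffix s marks the opposite arrows a*, x*, y*. *)
datatype arrow = ar_a | ar_as | ar_x | ar_xs | ar_y | ar_ys

fun src :: "arrow \<Rightarrow> vertex" where
  "src ar_a = V1" | "src ar_as = V1"
| "src ar_x = V2" | "src ar_xs = V1"
| "src ar_y = V1" | "src ar_ys = V2"

fun tgt :: "arrow \<Rightarrow> vertex" where
  "tgt ar_a = V1" | "tgt ar_as = V1"
| "tgt ar_x = V1" | "tgt ar_xs = V2"
| "tgt ar_y = V2" | "tgt ar_ys = V1"

(* The pair (u, [r1, ..., rk]) stands for the path r1 ... rk ending at u; composition is from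
   right to left, so rk is traversed first. The pair (u, []) is the trivial path at u. *)
type_synonym path = "vertex \<times> arrow list"

fun is_path :: "vertex \<Rightarrow> arrow list \<Rightarrow> bool" where
  "is_path u [] \<longleftrightarrow> True"
| "is_path u (r # rs) \<longleftrightarrow> tgt r = u \<and> is_path (src r) rs"

fun path_src :: "vertex \<Rightarrow> arrow list \<Rightarrow> vertex" where
  "path_src u [] = u"
| "path_src u (r # rs) = path_src (src r) rs"

lemma path_src_append: "path_src u (l1 @ l2) = path_src (path_src u l1) l2"
  by (induction u l1 rule: path_src.induct) auto

lemma is_path_append: "is_path u (l1 @ l2) \<longleftrightarrow> is_path u l1 \<and> is_path (path_src u l1) l2"
  by (induction u l1 rule: path_src.induct) auto

typedef palg =
  "{f :: path \<Rightarrow> complex. finite {p. f p \<noteq> 0} \<and> (\<forall>u l. f (u, l) \<noteq> 0 \<longrightarrow> is_path u l)}"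
  morphisms pcoeff Abs_palg
  by (rule exI[of _ "\<lambda>_. 0"]) simp

setup_lifting type_definition_palg

lemma palg_eqI: "(\<And>u l. pcoeff f (u, l) = pcoeff g (u, l)) \<Longrightarrow> f = g"
  by (metis pcoeff_inject ext surj_pair)

lemma finite_pcoeff: "finite {p. pcoeff f p \<noteq> 0}"
  using pcoeff[of f] by simp

lemma pcoeff_is_path: "pcoeff f (u, l) \<noteq> 0 \<Longrightarrow> is_path u l"
  using pcoeff[of f] by simp

lift_definition scale :: "complex \<Rightarrow> palg \<Rightarrow> palg" is "\<lambda>k f p. k * f p"
  by (auto elim: finite_subset[rotated])

lift_definition basis :: "path \<Rightarrow> palg"
  is "\<lambda>(u, l) p. if p = (u, l) \<and> is_path u l then 1 else 0"
  by (auto split: if_splits)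

abbreviation idem :: "vertex \<Rightarrow> palg" where
  "idem u \<equiv> basis (u, [])"

abbreviation arr :: "arrow \<Rightarrow> palg" where
  "arr r \<equiv> basis (tgt r, [r])"

instantiation palg :: ring_1
begin

lift_definition zero_palg :: palg is "\<lambda>_. 0" by simp

lift_definition plus_palg :: "palg \<Rightarrow> palg \<Rightarrow> palg" is "\<lambda>f g p. f p + g p"
proof -
  fix f g :: "path \<Rightarrow> complex"
  assume f: "finite {p. f p \<noteq> 0} \<and> (\<forall>u l. f (u, l) \<noteq> 0 \<longrightarrow> is_path u l)"
    and g: "finite {p. g p \<noteq> 0} \<and> (\<forall>u l. g (u, l) \<noteq> 0 \<longrightarrow> is_path u l)"
  have "{p. f p + g p \<noteq> 0} \<subseteq> {p. f p \<noteq> 0} \<union> {p. g p \<noteq> 0}" by auto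
  then have "finite {p. f p + g p \<noteq> 0}" by (rule finite_subset) (use f g in simp)
  with f g show "finite {p. f p + g p \<noteq> 0} \<and> (\<forall>u l. f (u, l) + g (u, l) \<noteq> 0 \<longrightarrow> is_path u l)"
    by (metis add_0)
qed

lift_definition uminus_palg :: "palg \<Rightarrow> palg" is "\<lambda>f p. - f p" by simp

definition minus_palg :: "palg \<Rightarrow> palg \<Rightarrow> palg" where
  "minus_palg f g = f + (- g)"

definition one_palg :: palg where
  "one_palg = idem V1 + idem V2"

(* A path can be split at each position k into a left factor and a right factor. *)
lift_definition times_palg :: "palg \<Rightarrow> palg \<Rightarrow> palg"
  is "\<lambda>f g (u, l). \<Sum>k\<le>length l. f (u, take k l) * g (path_src u (take k l), drop k l)"
proof -
  fix f g :: "path \<Rightarrow> complex"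
  assume f: "finite {p. f p \<noteq> 0} \<and> (\<forall>u l. f (u, l) \<noteq> 0 \<longrightarrow> is_path u l)"
    and g: "finite {p. g p \<noteq> 0} \<and> (\<forall>u l. g (u, l) \<noteq> 0 \<longrightarrow> is_path u l)"
  let ?h = "\<lambda>(u, l). \<Sum>k\<le>length l. f (u, take k l) * g (path_src u (take k l), drop k l)"
  have nz: "\<exists>k\<le>length l. f (u, take k l) \<noteq> 0 \<and> g (path_src u (take k l), drop k l) \<noteq> 0"
    if "?h (u, l) \<noteq> 0" for u l
  proof -
    from that obtain k where "k \<in> {..length l}"
      "f (u, take k l) * g (path_src u (take k l), drop k l) \<noteq> 0"
      unfolding prod.case by (rule sum.not_neutral_contains_not_neutral)
    then show ?thesis by (intro exI[of _ k]) simp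
  qed
  have "{p. ?h p \<noteq> 0} \<subseteq> (\<lambda>((u, l), (v, m)). (u, l @ m)) ` ({p. f p \<noteq> 0} \<times> {p. g p \<noteq> 0})"
  proof
    fix p assume "p \<in> {p. ?h p \<noteq> 0}"
    then obtain u l where p: "p = (u, l)" "?h (u, l) \<noteq> 0" by (cases p) auto
    from nz[OF p(2)] obtain k where
      k: "f (u, take k l) \<noteq> 0" "g (path_src u (take k l), drop k l) \<noteq> 0" by auto
    show "p \<in> (\<lambda>((u, l), (v, m)). (u, l @ m)) ` ({p. f p \<noteq> 0} \<times> {p. g p \<noteq> 0})"
      by (rule image_eqI[where x = "((u, take k l), (path_src u (take k l), drop k l))"])
        (use p k in auto)
  qed
  then have "finite {p. ?h p \<noteq> 0}"
    by (rule finite_subset) (use f g in simp)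
  moreover have "is_path u l" if "?h (u, l) \<noteq> 0" for u l
  proof -
    from nz[OF that] obtain k where
      "f (u, take k l) \<noteq> 0" "g (path_src u (take k l), drop k l) \<noteq> 0" by auto
    with f g have "is_path u (take k l)" "is_path (path_src u (take k l)) (drop k l)" by auto
    then show ?thesis using is_path_append[of u "take k l" "drop k l"] by simp
  qed
  ultimately show "finite {p. ?h p \<noteq> 0} \<and> (\<forall>u l. ?h (u, l) \<noteq> 0 \<longrightarrow> is_path u l)" by blast
qed

instance
proof
  fix f g h :: palg
  show "f + g + h = f + (g + h)" by transfer (auto simp: add.assoc)
  show "f + g = g + f" by transfer (auto simp: add.commute)
  show "0 + f = f" by transfer auto
  show "- f + f = 0" by transfer auto
  show "f - g = f + - g" by (simp add: minus_palg_def)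
  show "(f + g) * h = f * h + g * h"
    by transfer (auto simp: fun_eq_iff algebra_simps sum.distrib)
  show "f * (g + h) = f * g + f * h"
    by transfer (auto simp: fun_eq_iff algebra_simps sum.distrib)
  show "f * g * h = f * (g * h)"
  proof (rule palg_eqI)
    fix u :: vertex and l :: "arrow list"
    let ?n = "length l"
    let ?t = "\<lambda>j k. pcoeff f (u, take j l) *
      pcoeff g (path_src u (take j l), drop j (take k l)) *
      pcoeff h (path_src u (take k l), drop k l)"
    have "pcoeff (f * g * h) (u, l) = (\<Sum>k\<le>?n. \<Sum>j\<le>k. ?t j k)"
      unfolding times_palg.rep_eq prod.case sum_distrib_right
      by (intro sum.cong) (auto simp: min_absorb1 min_absorb2)
    also have "\<dots> = (\<Sum>j\<le>?n. \<Sum>i\<le>?n - j. ?t j (i + j))"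
      unfolding sum.Sigma[OF finite_atMost ballI[OF finite_atMost]]
      by (rule sum.reindex_bij_witness[where
            i = "\<lambda>(j, i). (i + j, j)" and j = "\<lambda>(k, j). (j, k - j)"]) auto
    also have "\<dots> = pcoeff (f * (g * h)) (u, l)"
    proof -
      have 1: "take i (drop j l) = drop j (take (i + j) l)" for i j
        by (rule take_drop)
      have 2: "path_src (path_src u (take j l)) (drop j (take (i + j) l)) = path_src u (take (i + j) l)"
        for i j
      proof -
        have "path_src (path_src u (take j l)) (take i (drop j l)) = path_src u (take (j + i) l)"
          unfolding take_add path_src_append ..
        then show ?thesis by (simp only: 1 add.commute[of j i])
      qed
      show ?thesis
        unfolding times_palg.rep_eq prod.case sum_distrib_left length_drop
        by (intro sum.cong refl) (simp only: 1 2 drop_drop mult.assoc)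
    qed
    finally show "pcoeff (f * g * h) (u, l) = pcoeff (f * (g * h)) (u, l)" .
  qed
  have one: "pcoeff 1 (v, m) = (if m = [] then 1 else 0)" for v m
    by (cases v) (auto simp: one_palg_def plus_palg.rep_eq basis.rep_eq)
  show "1 * f = f"
  proof (rule palg_eqI)
    fix u l
    have "pcoeff (1 * f) (u, l) =
        (\<Sum>k\<le>length l. if k = 0 then pcoeff f (u, l) else 0)"
      unfolding times_palg.rep_eq prod.case by (rule sum.cong[OF refl]) (auto simp: one)
    then show "pcoeff (1 * f) (u, l) = pcoeff f (u, l)" by simp
  qed
  show "f * 1 = f"
  proof (rule palg_eqI)
    fix u l
    have "pcoeff (f * 1) (u, l) =
        (\<Sum>k\<le>length l. if k = length l then pcoeff f (u, l) else 0)"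
      unfolding times_palg.rep_eq prod.case by (rule sum.cong[OF refl]) (auto simp: one)
    then show "pcoeff (f * 1) (u, l) = pcoeff f (u, l)" by simp
  qed
  show "(0 :: palg) \<noteq> 1"
  proof
    assume "(0 :: palg) = 1"
    then have "pcoeff 0 (V1, []) = pcoeff 1 (V1, [])" by (rule arg_cong)
    then show False by (simp only: one zero_palg.rep_eq) simp
  qed
qed

end

global_interpretation palg: vector_space scale
  by unfold_locales (transfer, auto simp: algebra_simps fun_eq_iff)+

definition commutator :: "palg \<Rightarrow> palg \<Rightarrow> palg" where
  "commutator f g = f * g - g * f"

definition c_elem :: palg where
  "c_elem = commutator (arr ar_a) (arr ar_as) + commutator (arr ar_x) (arr ar_xs)
    + commutator (arr ar_y) (arr ar_ys)"

section \<open>Symplectic automorphisms\<close>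

definition alg_aut :: "(palg \<Rightarrow> palg) \<Rightarrow> bool" where
  "alg_aut \<phi> \<longleftrightarrow> bij \<phi> \<and>
    (\<forall>f g. \<phi> (f + g) = \<phi> f + \<phi> g) \<and>
    (\<forall>f g. \<phi> (f * g) = \<phi> f * \<phi> g) \<and>
    (\<forall>k f. \<phi> (scale k f) = scale k (\<phi> f)) \<and>
    (\<forall>u. \<phi> (idem u) = idem u)"

definition Aut_c :: "(palg \<Rightarrow> palg) monoid" where
  "Aut_c = \<lparr>carrier = {\<phi>. alg_aut \<phi> \<and> \<phi> c_elem = c_elem}, monoid.mult = (\<circ>), one = id\<rparr>"

lemma group_Aut_c: "group Aut_c"
proof (rule groupI)
  fix \<phi> assume \<phi>: "\<phi> \<in> carrier Aut_c"
  then have b: "bij \<phi>" and \<phi>': "alg_aut \<phi>" "\<phi> c_elem = c_elem"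
    by (auto simp: Aut_c_def alg_aut_def)
  note s = surj_f_inv_f[OF bij_is_surj[OF b]] and i = inv_f_f[OF bij_is_inj[OF b]]
  have eq: "inv_into UNIV \<phi> f = g" if "\<phi> g = f" for f g
    using i[of g] that by simp
  have "inv_into UNIV \<phi> (f + g) = inv_into UNIV \<phi> f + inv_into UNIV \<phi> g"
    "inv_into UNIV \<phi> (f * g) = inv_into UNIV \<phi> f * inv_into UNIV \<phi> g"
    "inv_into UNIV \<phi> (scale k f) = scale k (inv_into UNIV \<phi> f)"
    "inv_into UNIV \<phi> (idem u) = idem u" "inv_into UNIV \<phi> c_elem = c_elem" for f g k u
    by (rule eq, use \<phi>' in \<open>simp add: alg_aut_def s\<close>)+
  with b have "inv_into UNIV \<phi> \<in> carrier Aut_c"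
    by (auto simp: Aut_c_def alg_aut_def bij_imp_bij_inv)
  moreover have "inv_into UNIV \<phi> \<circ> \<phi> = id" using i by (auto simp: fun_eq_iff)
  ultimately show "\<exists>\<psi>\<in>carrier Aut_c. \<psi> \<otimes>\<^bsub>Aut_c\<^esub> \<phi> = \<one>\<^bsub>Aut_c\<^esub>"
    by (auto simp: Aut_c_def)
qed (auto simp: Aut_c_def alg_aut_def comp_assoc bij_comp)

definition strictly_triangular :: "(palg \<Rightarrow> palg) \<Rightarrow> bool" where
  "strictly_triangular \<phi> \<longleftrightarrow>
    \<phi> (arr ar_a) = arr ar_a \<and> \<phi> (arr ar_x) = arr ar_x \<and> \<phi> (arr ar_y) = arr ar_y"

(* Affine transformations may have a constant term, i.e. a linear combination of e1 and e2. *)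
definition affine_aut :: "(palg \<Rightarrow> palg) \<Rightarrow> bool" where
  "affine_aut \<phi> \<longleftrightarrow> (\<forall>r. \<phi> (arr r) \<in> palg.span (range arr \<union> range idem))"

definition TAut_c :: "(palg \<Rightarrow> palg) monoid" where
  "TAut_c = subgroup_generated Aut_c
    ({\<phi> \<in> carrier Aut_c. strictly_triangular \<phi>} \<union> {\<phi> \<in> carrier Aut_c. affine_aut \<phi>})"

(* The pairs (I, T) with T = lambda I: the arrows -x, y* are transformed by T, and x*, y by the
   inverse of T. *)
definition Z_sub :: "(palg \<Rightarrow> palg) set" where
  "Z_sub = {\<phi> \<in> carrier Aut_c. affine_aut \<phi> \<and> (\<exists>k. k \<noteq> 0 \<and>
      \<phi> (arr ar_a) = arr ar_a \<and> \<phi> (arr ar_as) = arr ar_as \<and>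
      \<phi> (arr ar_x) = scale k (arr ar_x) \<and> \<phi> (arr ar_ys) = scale k (arr ar_ys) \<and>
      \<phi> (arr ar_xs) = scale (inverse k) (arr ar_xs) \<and> \<phi> (arr ar_y) = scale (inverse k) (arr ar_y))}"

definition PTAut_c :: "(palg \<Rightarrow> palg) set monoid" where
  "PTAut_c = TAut_c Mod Z_sub"

(* The endomorphism over C^2 that sends each arrow r to h r (for h r in e_(tgt r) A e_(src r)). *)
definition arrow_subst :: "(arrow \<Rightarrow> palg) \<Rightarrow> palg \<Rightarrow> palg" where
  "arrow_subst h f = (\<Sum>(u, l) | pcoeff f (u, l) \<noteq> 0. scale (pcoeff f (u, l)) (idem u * prod_list (map h l)))"

fun F_gen :: "arrow \<Rightarrow> palg" where
  "F_gen ar_a = - arr ar_as"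
| "F_gen ar_as = arr ar_a"
| "F_gen ar_x = - arr ar_ys"
| "F_gen ar_xs = arr ar_y"
| "F_gen ar_y = - arr ar_xs"
| "F_gen ar_ys = arr ar_x"

lemma arrow_subst_basis: "is_path u l \<Longrightarrow> arrow_subst h (basis (u, l)) = idem u * prod_list (map h l)"
proof -
  assume "is_path u l"
  then have "{(v, m). pcoeff (basis (u, l)) (v, m) \<noteq> 0} = {(u, l)}" "pcoeff (basis (u, l)) (u, l) = 1"
    by (auto simp: basis.rep_eq)
  then show ?thesis by (simp add: arrow_subst_def)
qed

lemma basis_mult:
  assumes "is_path u l" "is_path v m"
  shows "basis (u, l) * basis (v, m) = (if path_src u l = v then basis (u, l @ m) else 0)"
proof (rule palg_eqI)
  fix u' :: vertex and l' :: "arrow list"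
  have "pcoeff (basis (u, l) * basis (v, m)) (u', l') =
    (\<Sum>k\<le>length l'. if k = length l then (if u' = u \<and> l' = l @ m \<and> path_src u l = v then 1 else 0) else 0)"
    unfolding times_palg.rep_eq prod.case
  proof (rule sum.cong[OF refl])
    fix k assume "k \<in> {..length l'}"
    then have "k \<le> length l'" by simp
    then have *: "take k l' = l \<and> drop k l' = m \<longleftrightarrow> k = length l \<and> l' = l @ m"
      by auto
    then show "pcoeff (basis (u, l)) (u', take k l') *
        pcoeff (basis (v, m)) (path_src u' (take k l'), drop k l') =
        (if k = length l then (if u' = u \<and> l' = l @ m \<and> path_src u l = v then 1 else 0) else 0)"
    proof (cases "k = length l \<and> l' = l @ m")
      case True
      then show ?thesis using assms by (auto simp: basis.rep_eq)
    next
      case False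
      then have "take k l' \<noteq> l \<or> drop k l' \<noteq> m" using * by blast
      then show ?thesis using False by (auto simp: basis.rep_eq)
    qed
  qed
  then show "pcoeff (basis (u, l) * basis (v, m)) (u', l') =
      pcoeff (if path_src u l = v then basis (u, l @ m) else 0) (u', l')"
    using assms by (auto simp: basis.rep_eq zero_palg.rep_eq is_path_append)
qed

lemma arrow_subst_F_gen: "arrow_subst F_gen (idem u) = idem u" "arrow_subst F_gen (arr r) = F_gen r"
proof -
  show "arrow_subst F_gen (idem u) = idem u" by (simp add: arrow_subst_basis)
  have "arrow_subst F_gen (arr r) = idem (tgt r) * F_gen r" by (simp add: arrow_subst_basis)
  also have "\<dots> = F_gen r" by (cases r) (simp_all add: basis_mult)
  finally show "arrow_subst F_gen (arr r) = F_gen r" .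
qed

definition F_class :: "(palg \<Rightarrow> palg) set" where
  "F_class = Z_sub #>\<^bsub>TAut_c\<^esub> arrow_subst F_gen"

section \<open>The variety and the action\<close>

(* (X, Y, v, w) *)
type_synonym 'n quad =
  "(complex ^ 'n ^ 'n) \<times> (complex ^ 'n ^ 'n) \<times> (complex ^ 2 ^ 'n) \<times> (complex ^ 'n ^ 2)"

(* (A0, B0, X1, X2, Y1, Y2), the values of a, a*, x, y*, y, x* *)
type_synonym 'n rep =
  "(complex ^ 'n ^ 'n) \<times> (complex ^ 'n ^ 'n) \<times> (complex ^ 1 ^ 'n) \<times> (complex ^ 1 ^ 'n)
    \<times> (complex ^ 'n ^ 1) \<times> (complex ^ 'n ^ 1)"

definition moment :: "'n::finite quad \<Rightarrow> complex ^ 'n ^ 'n" where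
  "moment = (\<lambda>(X, Y, v, w). X ** Y - Y ** X + v ** w)"

definition gl_act :: "complex ^ 'n ^ 'n \<Rightarrow> 'n::finite quad \<Rightarrow> 'n quad" where
  "gl_act g = (\<lambda>(X, Y, v, w).
    (g ** X ** matrix_inv g, g ** Y ** matrix_inv g, g ** v, w ** matrix_inv g))"

definition level :: "complex \<Rightarrow> 'n::finite quad set" where
  "level \<tau> = {q. moment q = mat \<tau>}"

definition C_var :: "complex \<Rightarrow> 'n::finite quad set set" where
  "C_var \<tau> = level \<tau> // {(q, q'). q \<in> level \<tau> \<and> (\<exists>g. invertible g \<and> q' = gl_act g q)}"

definition to_rep :: "'n::finite quad \<Rightarrow> 'n rep" where
  "to_rep = (\<lambda>(X, Y, v, w).
    (X, Y, \<chi> i j. v $ i $ 1, \<chi> i j. - (v $ i $ 2), \<chi> i j. w $ 2 $ j, \<chi> i j. w $ 1 $ j))"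

definition of_rep :: "'n::finite rep \<Rightarrow> 'n quad" where
  "of_rep = (\<lambda>(A0, B0, X1, X2, Y1, Y2).
    (A0, B0, \<chi> i j. if j = 1 then X1 $ i $ 1 else - (X2 $ i $ 1),
      \<chi> i j. if i = 1 then Y2 $ 1 $ j else Y1 $ 1 $ j))"

(* A representation of dimension vector (n, 1) is evaluated inside square matrices of size n + 1:
   a matrix from vertex s to vertex t is placed in the block with rows t and columns s. *)
definition block11 :: "complex ^ 'n ^ 'n \<Rightarrow> complex ^ ('n + 1) ^ ('n::finite + 1)" where
  "block11 M = (\<chi> i j. case (i, j) of (Inl k, Inl l) \<Rightarrow> M $ k $ l | _ \<Rightarrow> 0)"

definition block12 :: "complex ^ 1 ^ 'n \<Rightarrow> complex ^ ('n + 1) ^ ('n::finite + 1)" where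
  "block12 M = (\<chi> i j. case (i, j) of (Inl k, Inr l) \<Rightarrow> M $ k $ l | _ \<Rightarrow> 0)"

definition block21 :: "complex ^ 'n ^ 1 \<Rightarrow> complex ^ ('n + 1) ^ ('n::finite + 1)" where
  "block21 M = (\<chi> i j. case (i, j) of (Inr k, Inl l) \<Rightarrow> M $ k $ l | _ \<Rightarrow> 0)"

definition block22 :: "complex ^ 1 ^ 1 \<Rightarrow> complex ^ ('n + 1) ^ ('n::finite + 1)" where
  "block22 M = (\<chi> i j. case (i, j) of (Inr k, Inr l) \<Rightarrow> M $ k $ l | _ \<Rightarrow> 0)"

fun arrow_mat :: "'n::finite rep \<Rightarrow> arrow \<Rightarrow> complex ^ ('n + 1) ^ ('n + 1)" where
  "arrow_mat (A0, B0, X1, X2, Y1, Y2) ar_a = block11 A0"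
| "arrow_mat (A0, B0, X1, X2, Y1, Y2) ar_as = block11 B0"
| "arrow_mat (A0, B0, X1, X2, Y1, Y2) ar_x = block12 X1"
| "arrow_mat (A0, B0, X1, X2, Y1, Y2) ar_ys = block12 X2"
| "arrow_mat (A0, B0, X1, X2, Y1, Y2) ar_y = block21 Y1"
| "arrow_mat (A0, B0, X1, X2, Y1, Y2) ar_xs = block21 Y2"

fun vertex_mat :: "vertex \<Rightarrow> complex ^ ('n::finite + 1) ^ ('n + 1)" where
  "vertex_mat V1 = block11 (mat 1)"
| "vertex_mat V2 = block22 (mat 1)"

fun path_mat :: "'n::finite rep \<Rightarrow> vertex \<Rightarrow> arrow list \<Rightarrow> complex ^ ('n + 1) ^ ('n + 1)" where
  "path_mat p u [] = vertex_mat u"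
| "path_mat p u (r # rs) = arrow_mat p r ** path_mat p (src r) rs"

definition eval_at :: "'n::finite rep \<Rightarrow> palg \<Rightarrow> complex ^ ('n + 1) ^ ('n + 1)" where
  "eval_at p f =
    (\<chi> i j. \<Sum>(u, l) | pcoeff f (u, l) \<noteq> 0. pcoeff f (u, l) * path_mat p u l $ i $ j)"

definition get11 :: "complex ^ ('n + 1) ^ ('n::finite + 1) \<Rightarrow> complex ^ 'n ^ 'n" where
  "get11 M = (\<chi> i j. M $ Inl i $ Inl j)"

definition get12 :: "complex ^ ('n + 1) ^ ('n::finite + 1) \<Rightarrow> complex ^ 1 ^ 'n" where
  "get12 M = (\<chi> i j. M $ Inl i $ Inr j)"

definition get21 :: "complex ^ ('n + 1) ^ ('n::finite + 1) \<Rightarrow> complex ^ 'n ^ 1" where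
  "get21 M = (\<chi> i j. M $ Inr i $ Inl j)"

definition rep_act :: "(palg \<Rightarrow> palg) \<Rightarrow> 'n::finite rep \<Rightarrow> 'n rep" where
  "rep_act \<phi> p =
    (get11 (eval_at p (\<phi> (arr ar_a))), get11 (eval_at p (\<phi> (arr ar_as))),
     get12 (eval_at p (\<phi> (arr ar_x))), get12 (eval_at p (\<phi> (arr ar_ys))),
     get21 (eval_at p (\<phi> (arr ar_y))), get21 (eval_at p (\<phi> (arr ar_xs))))"

definition quad_act :: "(palg \<Rightarrow> palg) \<Rightarrow> 'n::finite quad \<Rightarrow> 'n quad" where
  "quad_act \<phi> q = of_rep (rep_act \<phi> (to_rep q))"

(* A class of automorphisms acts on an orbit by applying all representatives to all points; since
   evaluation is GL_n-equivariant and Z moves points only within their orbits, the result is the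
   orbit of the image of any single point under any single representative. *)
definition PT_act :: "(palg \<Rightarrow> palg) set \<Rightarrow> 'n::finite quad set \<Rightarrow> 'n quad set" where
  "PT_act \<Phi> \<xi> = (\<Union>\<phi>\<in>\<Phi>. quad_act \<phi> ` \<xi>)"

definition regular_semisimple :: "complex ^ 'n ^ 'n::finite \<Rightarrow> bool" where
  "regular_semisimple X \<longleftrightarrow> (\<exists>(g :: complex ^ 'n ^ 'n) (d :: 'n \<Rightarrow> complex). invertible g \<and> inj d \<and>
    g ** X ** matrix_inv g = (\<chi> i j. if i = j then d i else 0))"

definition R_var :: "complex \<Rightarrow> 'n::finite quad set set" where
  "R_var \<tau> =
    {\<xi> \<in> C_var \<tau>. \<exists>X Y v w. (X, Y, v, w) \<in> \<xi> \<and> (regular_semisimple X \<or> regular_semisimple Y)}"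

section \<open>The group of matrix-valued functions\<close>

definition Gamma_sc :: "(complex \<Rightarrow> complex ^ 2 ^ 2) monoid" where
  "Gamma_sc = \<lparr>carrier = {\<lambda>z. mat (exp (poly p z)) | p :: complex poly. coeff p 0 = 0},
    monoid.mult = (\<lambda>f g z. f z ** g z), one = (\<lambda>z. mat 1)\<rparr>"

definition GL2_poly :: "(complex poly ^ 2 ^ 2) monoid" where
  "GL2_poly = \<lparr>carrier = {M. invertible M}, monoid.mult = (**), one = mat 1\<rparr>"

definition PGL2_poly :: "(complex poly ^ 2 ^ 2) set monoid" where
  "PGL2_poly = GL2_poly Mod {mat [:k:] | k :: complex. k \<noteq> 0}"

definition Gamma_alg :: "((complex \<Rightarrow> complex ^ 2 ^ 2) \<times> (complex poly ^ 2 ^ 2) set) monoid" where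
  "Gamma_alg = Gamma_sc \<times>\<times> PGL2_poly"

end

theory Submission
  imports Defs
begin

text \<open>
  The strictly triangular automorphisms attached to the Hamiltonians $\int Q(a) + y P(a) x$ form an
  abelian group. On a point with $X$ diagonal with distinct eigenvalues they and their rotations act
  through interpolation as arbitrary unipotent matrices on each pair
  $(v_{i\bullet}, w_{\bullet i})$ separately, and shift the diagonal of $Y$ arbitrarily. Since
  $v_{i\bullet} w_{\bullet i} = \tau \neq 0$, any such point can be moved to a rank one
  Calogero--Moser matrix with arbitrary diagonal of $Y$, so only the spectrum of $X$ matters. By
  Brouwer's theorem the diagonal can be chosen such that $Y$ has any prescribed, sufficiently
  separated spectrum. Applying $\mathcal{F}$, which exchanges $X$ and $Y$ up to sign, two arbitrary
  spectra of $X$ are thus connected to a common third one.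
\<close>

section \<open>Homomorphisms out of the path algebra\<close>

text \<open>With X = diag d, a polynomial triangular move controls the rows of v and the columns of
  w, but also changes Y by a term depending on them. This is harmless: on \<open>level\<close> the
  moment equation gives (d i - d j) Y_ij + v_i w_j = 0 for i \<noteq> j, so the off-diagonal part of
  Y is a function of d, v, w, while the diagonal part is free. Intermediate matrices Y therefore
  stay existentially quantified and are recovered only at the end.

  The triangular group supplies unipotents of one kind. Conjugation by F gives the opposite kind for
  constant P, because a constant P leaves both X and Y alone. Three constant moves form the Weyl
  element of SL_2 without moving X or Y, and conjugation by it, not by F, yields opposite unipotents
  with arbitrary polynomial entries.

  All these moves preserve the spectrum of X. The spectrum reachable for Y need not be arbitrary:
  the target is chosen after both points are known, so spectra separated by a bound depending on the
  points suffice.\<close>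

lemma pcoeff_sum: "pcoeff (sum g S) p = (\<Sum>s\<in>S. pcoeff (g s) p)"
  by (induction S rule: infinite_finite_induct) (auto simp: zero_palg.rep_eq plus_palg.rep_eq)

lemma palg_expand: "f = (\<Sum>p | pcoeff f p \<noteq> 0. scale (pcoeff f p) (basis p))"
proof (rule palg_eqI)
  fix u l
  have "pcoeff (\<Sum>p | pcoeff f p \<noteq> 0. scale (pcoeff f p) (basis p)) (u, l) =
    (\<Sum>p | pcoeff f p \<noteq> 0. if p = (u, l) then pcoeff f (u, l) else 0)"
    unfolding pcoeff_sum
    by (rule sum.cong[OF refl])
      (auto simp: scale.rep_eq basis.rep_eq dest: pcoeff_is_path split: if_splits)
  then show "pcoeff f (u, l) = pcoeff (\<Sum>p | pcoeff f p \<noteq> 0. scale (pcoeff f p) (basis p)) (u, l)"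
    using finite_pcoeff by (auto simp: sum.delta')
qed

lemma palg_induct [case_names zero add basis]:
  assumes "P 0" and add: "\<And>f g. P f \<Longrightarrow> P g \<Longrightarrow> P (f + g)"
    and b: "\<And>k u l. is_path u l \<Longrightarrow> P (scale k (basis (u, l)))"
  shows "P f"
proof -
  have "P (\<Sum>p\<in>S. scale (pcoeff f p) (basis p))" if "finite S" "S \<subseteq> {p. pcoeff f p \<noteq> 0}" for S
    using that
  proof (induction S)
    case (insert p S)
    then show ?case
      by (cases p) (auto intro!: add b pcoeff_is_path[of f])
  qed (use assms in auto)
  from this[OF finite_pcoeff subset_refl] show ?thesis
    using palg_expand by metis
qed

lemma scale_mult_left [simp]: "scale k f * g = scale k (f * g)"
  by transfer (auto simp: fun_eq_iff sum_distrib_left mult_ac)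

lemma scale_mult_right [simp]: "f * scale k g = scale k (f * g)"
  by transfer (auto simp: fun_eq_iff sum_distrib_left mult_ac)

lemma idem_mult: "idem u * idem v = (if u = v then idem u else 0)"
  by (simp add: basis_mult)

lemma basis_not_path: "\<not> is_path u l \<Longrightarrow> basis (u, l) = 0"
  by (rule palg_eqI) (simp add: basis.rep_eq zero_palg.rep_eq)

lemma idem_arr: "idem u * basis (v, l) = (if u = v then basis (v, l) else 0)"
  by (cases "is_path v l") (simp_all add: basis_mult basis_not_path)

lemma arr_idem: "basis (v, [r]) * idem u = (if u = src r then basis (v, [r]) else 0)"
  by (cases "is_path v [r]") (auto simp: basis_mult basis_not_path)

lemma basis_Cons: "is_path u (r # rs) \<Longrightarrow> basis (u, r # rs) = arr r * basis (src r, rs)"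
  by (simp add: basis_mult)

text \<open>Product and scalar action are parameters, so that one notion covers endomorphisms of
  \<open>palg\<close> and evaluation at matrices under \<open>**\<close>.\<close>

definition alg_hom_to ::
  "('b \<Rightarrow> 'b \<Rightarrow> 'b) \<Rightarrow> (complex \<Rightarrow> 'b \<Rightarrow> 'b) \<Rightarrow> (palg \<Rightarrow> 'b::ab_group_add) \<Rightarrow> bool" where
  "alg_hom_to mul sc \<Phi> \<longleftrightarrow> (\<forall>f g. \<Phi> (f + g) = \<Phi> f + \<Phi> g) \<and>
    (\<forall>f g. \<Phi> (f * g) = mul (\<Phi> f) (\<Phi> g)) \<and> (\<forall>k f. \<Phi> (scale k f) = sc k (\<Phi> f))"

lemma alg_hom_toD:
  assumes "alg_hom_to mul sc \<Phi>"
  shows "\<Phi> (f + g) = \<Phi> f + \<Phi> g" "\<Phi> (f * g) = mul (\<Phi> f) (\<Phi> g)" "\<Phi> (scale k f) = sc k (\<Phi> f)"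
    "\<Phi> 0 = 0" "\<Phi> (- f) = - \<Phi> f" "\<Phi> (f - g) = \<Phi> f - \<Phi> g"
proof -
  show add: "\<Phi> (f + g) = \<Phi> f + \<Phi> g" for f g using assms by (simp add: alg_hom_to_def)
  show "\<Phi> (f * g) = mul (\<Phi> f) (\<Phi> g)" "\<Phi> (scale k f) = sc k (\<Phi> f)"
    using assms by (simp_all add: alg_hom_to_def)
  show 0: "\<Phi> 0 = 0" using add[of 0 0] by simp
  show m: "\<Phi> (- f) = - \<Phi> f" for f using add[of f "- f"] by (simp add: 0 eq_neg_iff_add_eq_0 add.commute)
  show "\<Phi> (f - g) = \<Phi> f - \<Phi> g" using add[of f "- g"] by (simp add: m)
qed

lemma alg_hom_to_sum:
  assumes "alg_hom_to mul sc \<Phi>"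
  shows "\<Phi> (sum g S) = (\<Sum>s\<in>S. \<Phi> (g s))"
  by (induction S rule: infinite_finite_induct) (auto simp: alg_hom_toD[OF assms])

lemma alg_hom_to_eqI:
  assumes \<Phi>: "alg_hom_to mul sc \<Phi>" and \<Psi>: "alg_hom_to mul sc \<Psi>"
    and idem: "\<And>u. \<Phi> (idem u) = \<Psi> (idem u)" and arr: "\<And>r. \<Phi> (arr r) = \<Psi> (arr r)"
  shows "\<Phi> f = \<Psi> f"
proof (induction f rule: palg_induct)
  case (basis k u l)
  then have "\<Phi> (basis (u, l)) = \<Psi> (basis (u, l))"
  proof (induction l arbitrary: u)
    case (Cons r rs)
    then show ?case by (simp add: basis_Cons alg_hom_toD[OF \<Phi>] alg_hom_toD[OF \<Psi>] arr del: is_path.simps) simp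
  qed (simp add: idem)
  then show ?case by (simp add: alg_hom_toD[OF \<Phi>] alg_hom_toD[OF \<Psi>])
qed (simp_all add: alg_hom_toD[OF \<Phi>] alg_hom_toD[OF \<Psi>])

text \<open>The data for the universal property of the path algebra: orthogonal idempotents at the
  vertices, and arrows lying in the matching Peirce blocks. The instances are arrow substitutions in
  \<open>palg\<close> and evaluation at a representation.\<close>

locale path_target =
  fixes mul :: "'b \<Rightarrow> 'b \<Rightarrow> 'b::ab_group_add" and sc :: "complex \<Rightarrow> 'b \<Rightarrow> 'b"
    and E :: "vertex \<Rightarrow> 'b" and R :: "arrow \<Rightarrow> 'b"
  assumes mul_assoc: "mul (mul m n) p = mul m (mul n p)"
    and mul_add: "mul m (n + p) = mul m n + mul m p"
    and add_mul: "mul (m + n) p = mul m p + mul n p"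
    and sc_add: "sc (j + k) m = sc j m + sc k m"
    and sc_add_right: "sc k (m + n) = sc k m + sc k n"
    and sc_sc: "sc (j * k) m = sc j (sc k m)"
    and sc_one: "sc 1 m = m"
    and sc_mul: "mul (sc k m) n = sc k (mul m n)"
    and mul_sc: "mul m (sc k n) = sc k (mul m n)"
    and E_E: "mul (E u) (E v) = (if u = v then E u else 0)"
    and E_R: "mul (E (tgt r)) (R r) = R r"
    and R_E: "mul (R r) (E (src r)) = R r"
begin

fun pm :: "vertex \<Rightarrow> arrow list \<Rightarrow> 'b" where
  "pm u [] = E u"
| "pm u (r # rs) = mul (R r) (pm (src r) rs)"

definition lift_hom :: "palg \<Rightarrow> 'b" where
  "lift_hom f = (\<Sum>(u, l) | pcoeff f (u, l) \<noteq> 0. sc (pcoeff f (u, l)) (pm u l))"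

lemma mul_0: "mul m 0 = 0" and zero_mul: "mul 0 m = 0" and sc_0: "sc 0 m = 0"
  and sc_zero: "sc k 0 = 0"
  using mul_add[of m 0 0] add_mul[of 0 0 m] sc_add[of 0 0 m] sc_add_right[of k 0 0] by auto

lemma lift_hom_superset:
  assumes "finite S" "{p. pcoeff f p \<noteq> 0} \<subseteq> S"
  shows "lift_hom f = (\<Sum>p\<in>S. sc (pcoeff f p) (pm (fst p) (snd p)))"
proof -
  have "(\<Sum>p\<in>S. sc (pcoeff f p) (pm (fst p) (snd p))) =
      (\<Sum>p | pcoeff f p \<noteq> 0. sc (pcoeff f p) (pm (fst p) (snd p)))"
    by (rule sum.mono_neutral_right) (use assms in \<open>auto simp: sc_0\<close>)
  then show ?thesis unfolding lift_hom_def by (simp add: case_prod_beta' cong: sum.cong)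
qed

lemma lift_hom_add: "lift_hom (f + g) = lift_hom f + lift_hom g"
proof -
  let ?S = "{p. pcoeff f p \<noteq> 0} \<union> {p. pcoeff g p \<noteq> 0}"
  have "finite ?S" using finite_pcoeff by simp
  then show ?thesis
    by (subst (1 2 3) lift_hom_superset[of ?S]) (auto simp: plus_palg.rep_eq sc_add sum.distrib)
qed

lemma sc_sum: "sc k (sum g S) = (\<Sum>s\<in>S. sc k (g s))"
  by (induction S rule: infinite_finite_induct) (auto simp: sc_zero sc_add_right)

lemma lift_hom_scale: "lift_hom (scale k f) = sc k (lift_hom f)"
proof -
  let ?S = "{p. pcoeff f p \<noteq> 0}"
  have "finite ?S" using finite_pcoeff by simp
  then show ?thesis
    by (subst (1 2) lift_hom_superset[of ?S]) (auto simp: scale.rep_eq sc_sc sc_sum)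
qed

lemma lift_hom_basis: "is_path u l \<Longrightarrow> lift_hom (basis (u, l)) = pm u l"
  by (subst lift_hom_superset[of "{(u, l)}"]) (auto simp: basis.rep_eq sc_one split: if_splits)

lemma pm_mult:
  "is_path u l \<Longrightarrow> is_path v m \<Longrightarrow> mul (pm u l) (pm v m) = (if path_src u l = v then pm u (l @ m) else 0)"
proof (induction l arbitrary: u)
  case Nil
  show ?case
  proof (cases m)
    case (Cons r rs)
    with Nil have v: "v = tgt r" by simp
    have "mul (E u) (R r) = (if u = tgt r then R r else 0)"
      using mul_assoc[of "E u" "E (tgt r)" "R r"] by (simp add: E_E E_R zero_mul split: if_splits)
    then show ?thesis using Cons v mul_assoc[of "E u" "R r"] by (auto simp: zero_mul)
  qed (simp add: E_E)
next
  case (Cons r rs)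
  then show ?case by (simp add: mul_assoc mul_0)
qed

lemma alg_hom_lift_hom: "alg_hom_to mul sc lift_hom"
proof -
  have bb: "lift_hom (scale j (basis (u, l)) * scale k (basis (v, m))) =
      mul (lift_hom (scale j (basis (u, l)))) (lift_hom (scale k (basis (v, m))))"
    if "is_path u l" "is_path v m" for j k u l v m
  proof -
    have "lift_hom (basis (u, l) * basis (v, m)) = mul (lift_hom (basis (u, l))) (lift_hom (basis (v, m)))"
      using that lift_hom_scale[of 0 0]
      by (auto simp: basis_mult pm_mult lift_hom_basis is_path_append sc_0)
    then show ?thesis by (simp add: lift_hom_scale sc_mul mul_sc del: palg.scale_scale)
  qed
  have z: "lift_hom 0 = 0" using lift_hom_scale[of 0 0] by (simp add: sc_0)
  have "lift_hom (f * g) = mul (lift_hom f) (lift_hom g)" for f g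
  proof (induction f rule: palg_induct)
    case (basis j u l)
    then have u: "is_path u l" .
    show ?case
      by (induction g rule: palg_induct)
        (use u in \<open>simp_all only: bb distrib_left lift_hom_add mul_add mult_zero_right z mul_0\<close>)
  qed (simp_all add: distrib_right lift_hom_add add_mul z zero_mul)
  then show ?thesis by (auto simp: alg_hom_to_def lift_hom_add lift_hom_scale)
qed

end

lemma arrow_subst_path_target:
  assumes "\<And>r. idem (tgt r) * h r = h r" "\<And>r. h r * idem (src r) = h r"
  shows "path_target (*) scale idem h"
  by unfold_locales (use assms in \<open>simp_all add: algebra_simps idem_mult\<close>)

text \<open>Each \<open>h r\<close> absorbs the idempotents at its ends, so the single leading
  idempotent in \<open>arrow_subst\<close> gives the same product as the lift that ends in the
  trivial path at the source.\<close>

lemma arrow_subst_hom: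
  assumes h: "\<And>r. idem (tgt r) * h r = h r" "\<And>r. h r * idem (src r) = h r"
  shows "alg_hom_to (*) scale (arrow_subst h)"
    and "arrow_subst h (idem u) = idem u" and "arrow_subst h (arr r) = h r"
proof -
  interpret path_target "(*)" scale idem h by (rule arrow_subst_path_target[OF h])
  have pm: "is_path u l \<Longrightarrow> pm u l = idem u * prod_list (map h l)" for u l
  proof (induction l arbitrary: u)
    case (Cons r rs)
    then have u: "u = tgt r" and "pm u (r # rs) = (h r * idem (src r)) * prod_list (map h rs)"
      by (simp_all add: mult.assoc)
    note this(2)
    also have "\<dots> = (idem (tgt r) * h r) * prod_list (map h rs)" by (simp add: h)
    finally show ?case by (simp add: u mult.assoc)
  qed simp
  have "arrow_subst h f = lift_hom f" for f
    unfolding arrow_subst_def lift_hom_def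
    by (rule sum.cong) (auto dest!: pcoeff_is_path simp: pm)
  then have eq: "arrow_subst h = lift_hom" by auto
  then show "alg_hom_to (*) scale (arrow_subst h)" by (simp add: alg_hom_lift_hom)
  show "arrow_subst h (idem u) = idem u" "arrow_subst h (arr r) = h r"
    by (simp_all add: arrow_subst_basis h)
qed

lemma alg_aut_hom: "alg_aut \<phi> \<Longrightarrow> alg_hom_to (*) scale \<phi>"
  by (simp add: alg_aut_def alg_hom_to_def)

lemma alg_hom_comp:
  "alg_hom_to mul sc \<Phi> \<Longrightarrow> alg_hom_to (*) scale \<phi> \<Longrightarrow> alg_hom_to mul sc (\<lambda>f. \<Phi> (\<phi> f))"
  by (simp add: alg_hom_to_def)

lemma alg_hom_id: "alg_hom_to (*) scale (\<lambda>f. f)"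
  by (simp add: alg_hom_to_def)

lemma alg_aut_block:
  assumes "alg_aut \<phi>"
  shows "idem (tgt r) * \<phi> (arr r) = \<phi> (arr r)" "\<phi> (arr r) * idem (src r) = \<phi> (arr r)"
proof -
  have "\<phi> (idem (tgt r) * arr r) = idem (tgt r) * \<phi> (arr r)"
    "\<phi> (arr r * idem (src r)) = \<phi> (arr r) * idem (src r)"
    using assms by (simp_all add: alg_aut_def)
  then show "idem (tgt r) * \<phi> (arr r) = \<phi> (arr r)" "\<phi> (arr r) * idem (src r) = \<phi> (arr r)"
    by (simp_all add: idem_arr arr_idem)
qed

section \<open>Symplectic automorphisms\<close>

text \<open>The linear map on polynomials that sends z^k to \<open>t k\<close>. It treats a^k x, y
  a^k and the non-multiplicative family \<open>tri_corr\<close> alike.\<close>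

definition lin :: "(nat \<Rightarrow> palg) \<Rightarrow> complex poly \<Rightarrow> palg" where
  "lin t p = (\<Sum>k\<le>degree p. scale (coeff p k) (t k))"

lemma lin_superset:
  assumes "degree p \<le> N"
  shows "lin t p = (\<Sum>k\<le>N. scale (coeff p k) (t k))"
  unfolding lin_def by (rule sum.mono_neutral_left) (use assms in \<open>auto simp: coeff_eq_0\<close>)

lemma lin_0 [simp]: "lin t 0 = 0"
  by (simp add: lin_def)

lemma lin_const [simp]: "lin t [:k:] = scale k (t 0)"
  by (simp add: lin_def)

lemma lin_poly_add: "lin t (p + q) = lin t p + lin t q"
proof -
  let ?N = "max (degree p) (degree q)"
  have "degree (p + q) \<le> ?N" by (rule degree_add_le_max)
  then show ?thesis
    by (simp add: lin_superset[of "p + q" ?N] lin_superset[of p ?N] lin_superset[of q ?N]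
        palg.scale_left_distrib sum.distrib)
qed

lemma lin_add: "lin t p + lin s p = lin (\<lambda>k. t k + s k) p"
  by (simp add: lin_def palg.scale_right_distrib sum.distrib)

lemma lin_diff: "lin t p - lin s p = lin (\<lambda>k. t k - s k) p"
  by (simp add: lin_def palg.scale_right_diff_distrib sum_subtractf)

lemma mult_lin: "f * lin t p = lin (\<lambda>k. f * t k) p"
  by (simp add: lin_def sum_distrib_left)

lemma lin_mult: "lin t p * f = lin (\<lambda>k. t k * f) p"
  by (simp add: lin_def sum_distrib_right)

lemma hom_lin: "alg_hom_to (*) scale \<phi> \<Longrightarrow> \<phi> (lin t p) = lin (\<lambda>k. \<phi> (t k)) p"
  by (simp add: lin_def alg_hom_to_sum alg_hom_toD)

lemma hom_power:
  assumes "alg_hom_to (*) scale \<phi>" "\<And>u. \<phi> (idem u) = idem u"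
  shows "\<phi> (f ^ k) = \<phi> f ^ k"
  by (induction k) (simp_all add: alg_hom_toD[OF assms(1)] assms(2) one_palg_def)

text \<open>The factor e1 matters for k = 0: there a^0 is e1 + e2, which would leave the block at
  vertex 1.\<close>

lemma idem_V1_power: "idem V1 * arr ar_a ^ k = arr ar_a ^ k * idem V1"
  by (rule power_commuting_commutes[symmetric]) (simp add: idem_arr arr_idem)

primrec tri_corr :: "nat \<Rightarrow> palg" where
  "tri_corr 0 = 0"
| "tri_corr (Suc k) = arr ar_x * arr ar_y * arr ar_a ^ k + arr ar_a * tri_corr k"

text \<open>Since \<open>tri_corr k\<close> is the sum of a^i x y a^j over i + j + 1 = k, its
  commutator with a telescopes and only the two end terms survive.\<close>

lemma commutator_tri_corr:
  "arr ar_a * tri_corr k - tri_corr k * arr ar_a =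
    arr ar_a ^ k * arr ar_x * arr ar_y - arr ar_x * arr ar_y * arr ar_a ^ k"
proof (induction k)
  case (Suc k)
  let ?a = "arr ar_a" and ?xy = "arr ar_x * arr ar_y"
  have "?a * tri_corr (Suc k) - tri_corr (Suc k) * ?a =
      ?a * (?xy * ?a ^ k + (?a * tri_corr k - tri_corr k * ?a)) - ?xy * ?a ^ Suc k"
    by (simp add: algebra_simps power_commutes)
  also have "\<dots> = ?a ^ Suc k * arr ar_x * arr ar_y - ?xy * ?a ^ Suc k"
    unfolding Suc by (simp add: algebra_simps)
  finally show ?case by simp
qed simp

lemma tri_corr_block: "idem V1 * tri_corr k = tri_corr k" "tri_corr k * idem V1 = tri_corr k"
proof -
  have 1: "idem V1 * (arr ar_x * arr ar_y * f) = arr ar_x * arr ar_y * f" for f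
    by (simp add: mult.assoc[symmetric] idem_arr)
  have 2: "idem V1 * (arr ar_a * f) = arr ar_a * f" for f
    by (simp add: mult.assoc[symmetric] idem_arr)
  have 3: "arr ar_x * arr ar_y * arr ar_a ^ k * idem V1 = arr ar_x * arr ar_y * arr ar_a ^ k" for k
  proof -
    have "arr ar_x * arr ar_y * arr ar_a ^ k * idem V1 = arr ar_x * (arr ar_y * idem V1) * arr ar_a ^ k"
      by (simp add: mult.assoc idem_V1_power[symmetric, simplified])
    then show ?thesis by (simp add: arr_idem)
  qed
  show "idem V1 * tri_corr k = tri_corr k"
    by (cases k) (simp_all add: distrib_left 1[simplified] 2[simplified])
  show "tri_corr k * idem V1 = tri_corr k"
    by (induction k) (simp_all add: distrib_right 3[simplified] mult.assoc[of "basis (V1, [ar_a])"])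
qed

text \<open>The Hamiltonian flow of the necklace polynomial $\int Q(a) + y P(a) x$; \<^const>\<open>tri_corr\<close> \<open>k\<close> is
  the derivative of the cyclic word $y a^k x$ with respect to $a$.\<close>

fun tri_gen :: "complex poly \<Rightarrow> complex poly \<Rightarrow> arrow \<Rightarrow> palg" where
  "tri_gen P Q ar_as = arr ar_as + lin (\<lambda>k. idem V1 * arr ar_a ^ k) Q + lin tri_corr P"
| "tri_gen P Q ar_xs = arr ar_xs + lin (\<lambda>k. arr ar_y * arr ar_a ^ k) P"
| "tri_gen P Q ar_ys = arr ar_ys + lin (\<lambda>k. arr ar_a ^ k * arr ar_x) P"
| "tri_gen P Q r = arr r"

definition tri :: "complex poly \<Rightarrow> complex poly \<Rightarrow> palg \<Rightarrow> palg" where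
  "tri P Q = arrow_subst (tri_gen P Q)"

lemma tri_gen_block:
  "idem (tgt r) * tri_gen P Q r = tri_gen P Q r" "tri_gen P Q r * idem (src r) = tri_gen P Q r"
proof -
  have 1: "idem v * (basis (v, l) * f) = basis (v, l) * f" for v l f
    by (simp_all add: mult.assoc[symmetric] idem_mult idem_arr)
  have 2: "idem V1 * arr ar_a ^ k * idem V1 = idem V1 * arr ar_a ^ k" for k
    unfolding idem_V1_power by (simp add: mult.assoc idem_mult)
  have 3: "idem V1 * (basis (V1, [ar_a]) ^ k * basis (V1, l)) = basis (V1, [ar_a]) ^ k * basis (V1, l)" for k l
    using idem_V1_power[of k] by (simp add: mult.assoc[symmetric]) (simp add: mult.assoc idem_arr)
  have 4: "arr ar_y * arr ar_a ^ k * idem V1 = arr ar_y * arr ar_a ^ k" for k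
    unfolding mult.assoc idem_V1_power[symmetric] by (simp add: mult.assoc[symmetric] arr_idem)
  have 5: "arr ar_a ^ k * arr ar_x * idem V2 = arr ar_a ^ k * arr ar_x" for k
    by (simp add: mult.assoc arr_idem)
  show "idem (tgt r) * tri_gen P Q r = tri_gen P Q r"
    by (cases r) (simp_all add: distrib_left idem_arr mult_lin tri_corr_block 1 3)
  show "tri_gen P Q r * idem (src r) = tri_gen P Q r"
    by (cases r) (simp_all add: distrib_right arr_idem lin_mult tri_corr_block 2[simplified] 4[simplified] 5[simplified])
qed

lemmas tri_hom = arrow_subst_hom[where h = "tri_gen P Q" for P Q, OF tri_gen_block, folded tri_def]

lemma tri_fixes:
  "tri P Q (lin (\<lambda>k. idem V1 * arr ar_a ^ k) p) = lin (\<lambda>k. idem V1 * arr ar_a ^ k) p"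
  "tri P Q (lin (\<lambda>k. arr ar_y * arr ar_a ^ k) p) = lin (\<lambda>k. arr ar_y * arr ar_a ^ k) p"
  "tri P Q (lin (\<lambda>k. arr ar_a ^ k * arr ar_x) p) = lin (\<lambda>k. arr ar_a ^ k * arr ar_x) p"
  "tri P Q (lin tri_corr p) = lin tri_corr p"
proof -
  note s = alg_hom_toD[OF tri_hom(1)] tri_hom(2,3) hom_power[OF tri_hom(1,2)]
  have 1: "tri P Q (tri_corr k) = tri_corr k" for k
    by (induction k) (simp_all only: tri_corr.simps s tri_gen.simps)
  show "tri P Q (lin (\<lambda>k. idem V1 * arr ar_a ^ k) p) = lin (\<lambda>k. idem V1 * arr ar_a ^ k) p"
    "tri P Q (lin (\<lambda>k. arr ar_y * arr ar_a ^ k) p) = lin (\<lambda>k. arr ar_y * arr ar_a ^ k) p"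
    "tri P Q (lin (\<lambda>k. arr ar_a ^ k * arr ar_x) p) = lin (\<lambda>k. arr ar_a ^ k * arr ar_x) p"
    "tri P Q (lin tri_corr p) = lin tri_corr p"
    by (simp_all only: hom_lin[OF tri_hom(1)] s 1 tri_gen.simps)
qed

text \<open>The correction terms are words in a, x, y, and these arrows are fixed by every
  \<open>tri\<close>; hence the corrections simply add up.\<close>

lemma tri_tri: "tri P Q \<circ> tri P' Q' = tri (P + P') (Q + Q')"
proof
  fix f
  have "tri P Q (tri P' Q' f) = tri (P + P') (Q + Q') f"
  proof (rule alg_hom_to_eqI[OF alg_hom_comp[OF tri_hom(1) tri_hom(1)] tri_hom(1)])
    fix r
    show "tri P Q (tri P' Q' (arr r)) = tri (P + P') (Q + Q') (arr r)"
      by (cases r) (simp_all only: tri_hom(3) tri_gen.simps alg_hom_toD[OF tri_hom(1)] tri_fixes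
          lin_poly_add ac_simps)
  qed (simp add: tri_hom(2))
  then show "(tri P Q \<circ> tri P' Q') f = tri (P + P') (Q + Q') f" by simp
qed

lemma tri_0: "tri 0 0 = id"
proof
  fix f
  show "tri 0 0 f = id f"
    unfolding id_def
  proof (rule alg_hom_to_eqI[OF tri_hom(1) alg_hom_id])
    show "tri 0 0 (arr r) = arr r" for r by (cases r) (simp_all only: tri_hom(3) tri_gen.simps lin_0 add_0_right)
  qed (simp add: tri_hom(2))
qed

lemma tri_c_elem: "tri P Q c_elem = c_elem"
proof -
  let ?a = "arr ar_a" and ?x = "arr ar_x" and ?y = "arr ar_y"
  let ?q = "lin (\<lambda>k. idem V1 * ?a ^ k) Q" and ?d = "lin tri_corr P"
  let ?s = "lin (\<lambda>k. ?y * ?a ^ k) P" and ?t = "lin (\<lambda>k. ?a ^ k * ?x) P"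
  have "?a * (idem V1 * ?a ^ k) = idem V1 * ?a ^ k * ?a" for k
    unfolding idem_V1_power by (simp only: mult.assoc[symmetric] power_commutes[symmetric])
      (simp add: mult.assoc idem_arr arr_idem)
  then have 1: "?a * ?q - ?q * ?a = 0" by (simp add: mult_lin lin_mult)
  \<comment> \<open>In degree k the three brackets are a^k x y - x y a^k, then x y a^k - y a^k x,
    then y a^k x - a^k x y; they cancel cyclically.\<close>
  have 2: "(?a * ?d - ?d * ?a) + (?x * ?s - ?s * ?x) + (?y * ?t - ?t * ?y) = 0"
    unfolding mult_lin lin_mult lin_diff lin_add commutator_tri_corr
    by (simp add: mult.assoc lin_def)
  have "tri P Q c_elem = c_elem + (?a * ?q - ?q * ?a) +
      ((?a * ?d - ?d * ?a) + (?x * ?s - ?s * ?x) + (?y * ?t - ?t * ?y))"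
    by (simp only: c_elem_def commutator_def alg_hom_toD[OF tri_hom(1)] tri_hom(3) tri_gen.simps)
      (simp add: algebra_simps)
  then show ?thesis by (simp only: 1 2 add_0_right)
qed

lemma alg_autI:
  assumes "alg_hom_to (*) scale \<phi>" "\<And>u. \<phi> (idem u) = idem u" "bij \<phi>"
  shows "alg_aut \<phi>"
  using assms by (simp add: alg_aut_def alg_hom_to_def)

lemma tri_Aut_c: "tri P Q \<in> carrier Aut_c"
proof -
  have "bij (tri P Q)"
    by (rule o_bij[of "tri (- P) (- Q)"]) (simp_all add: tri_tri tri_0)
  then show ?thesis
    by (simp add: Aut_c_def tri_c_elem alg_autI[OF tri_hom(1,2)])
qed

section \<open>The automorphism exchanging a and its opposite\<close>

lemma F_gen_block: "idem (tgt r) * F_gen r = F_gen r" "F_gen r * idem (src r) = F_gen r"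
  by (cases r, simp_all add: idem_arr arr_idem)+

lemmas F_hom = arrow_subst_hom[where h = F_gen, OF F_gen_block]

lemma F_Aut_c: "arrow_subst F_gen \<in> carrier Aut_c"
proof -
  let ?F = "arrow_subst F_gen"
  \<comment> \<open>The square of F negates every arrow, so its fourth power is the identity and its
    cube is the inverse.\<close>
  have "?F (?F (?F (?F f))) = f" for f
  proof (rule alg_hom_to_eqI[OF alg_hom_comp[OF alg_hom_comp[OF alg_hom_comp[OF F_hom(1) F_hom(1)]
      F_hom(1)] F_hom(1)] alg_hom_id])
    show "?F (?F (?F (?F (arr r)))) = arr r" for r
      by (cases r) (simp_all only: F_hom(3) F_gen.simps alg_hom_toD[OF F_hom(1)] minus_minus)
  qed (simp add: F_hom(2))
  then have "bij ?F"
    by (intro o_bij[of "?F \<circ> ?F \<circ> ?F"]) (simp_all add: fun_eq_iff)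
  moreover have "?F c_elem = c_elem"
    by (simp only: c_elem_def commutator_def F_hom(3) F_gen.simps alg_hom_toD[OF F_hom(1)])
      (simp add: algebra_simps)
  ultimately show ?thesis by (simp add: Aut_c_def alg_autI[OF F_hom(1,2)])
qed

lemma arr_in_span: "arr r \<in> palg.span (range arr \<union> range idem)"
  by (rule palg.span_base) auto

lemma F_affine: "affine_aut (arrow_subst F_gen)"
  unfolding affine_aut_def F_hom(3)
proof
  show "F_gen r \<in> palg.span (range arr \<union> range idem)" for r
    by (cases r) (auto intro!: palg.span_neg arr_in_span simp del: tgt.simps)
qed

section \<open>The tame group, its central subgroup and the quotient\<close>

lemma group_TAut_c: "group TAut_c"
  unfolding TAut_c_def by (rule group.group_subgroup_generated[OF group_Aut_c])

lemma TAut_c_carrier: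
  "\<phi> \<in> carrier Aut_c \<Longrightarrow> strictly_triangular \<phi> \<or> affine_aut \<phi> \<Longrightarrow> \<phi> \<in> carrier TAut_c"
  unfolding TAut_c_def carrier_subgroup_generated by (rule generate.incl) auto

lemma TAut_c_Aut_c: "\<phi> \<in> carrier TAut_c \<Longrightarrow> \<phi> \<in> carrier Aut_c"
  unfolding TAut_c_def using group.carrier_subgroup_generated_subset[OF group_Aut_c] by blast

lemma TAut_c_ops: "mult TAut_c = (\<circ>)" "\<one>\<^bsub>TAut_c\<^esub> = id"
  by (simp_all add: TAut_c_def Aut_c_def)

lemma tri_TAut_c: "tri P Q \<in> carrier TAut_c"
  by (rule TAut_c_carrier[OF tri_Aut_c])
    (simp add: strictly_triangular_def tri_hom(3) del: tgt.simps)

lemma F_TAut_c: "arrow_subst F_gen \<in> carrier TAut_c"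
  by (rule TAut_c_carrier[OF F_Aut_c]) (simp add: F_affine)

definition Z_scales :: "complex \<Rightarrow> (palg \<Rightarrow> palg) \<Rightarrow> bool" where
  "Z_scales k \<phi> \<longleftrightarrow> k \<noteq> 0 \<and>
      \<phi> (arr ar_a) = arr ar_a \<and> \<phi> (arr ar_as) = arr ar_as \<and>
      \<phi> (arr ar_x) = scale k (arr ar_x) \<and> \<phi> (arr ar_ys) = scale k (arr ar_ys) \<and>
      \<phi> (arr ar_xs) = scale (inverse k) (arr ar_xs) \<and> \<phi> (arr ar_y) = scale (inverse k) (arr ar_y)"

lemma Z_sub_iff: "\<phi> \<in> Z_sub \<longleftrightarrow> \<phi> \<in> carrier Aut_c \<and> (\<exists>k. Z_scales k \<phi>)"
proof -
  have "affine_aut \<phi>" if "Z_scales k \<phi>" for k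
    unfolding affine_aut_def
  proof
    show "\<phi> (arr r) \<in> palg.span (range arr \<union> range idem)" for r
      using that unfolding Z_scales_def
      by (cases r) (auto intro!: palg.span_scale arr_in_span simp del: tgt.simps)
  qed
  then show ?thesis unfolding Z_sub_def Z_scales_def[symmetric] by blast
qed

lemma alg_hom_inner:
  fixes u v :: palg
  assumes "v * u = 1"
  shows "alg_hom_to (*) scale (\<lambda>f. u * f * v)"
proof -
  have "u * (f * g) * v = (u * f * v) * (u * g * v)" for f g
  proof -
    have "(u * f * v) * (u * g * v) = u * f * (v * u) * g * v" by (simp only: mult.assoc)
    then show ?thesis by (simp add: assms mult.assoc)
  qed
  then show ?thesis by (simp add: alg_hom_to_def distrib_left distrib_right)
qed

text \<open>Elements of \<^const>\<open>Z_sub\<close> are inner automorphisms by $k e_1 + e_2$, hence commute with all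
  automorphisms over $\mathbb{C}^2$.\<close>

lemma Z_scales_inner:
  assumes "alg_aut \<zeta>" "Z_scales k \<zeta>"
  shows "\<zeta> f = (scale k (idem V1) + idem V2) * f * (scale (inverse k) (idem V1) + idem V2)"
proof (rule alg_hom_to_eqI[OF alg_aut_hom[OF assms(1)]])
  have k: "k \<noteq> 0" using assms(2) by (simp add: Z_scales_def)
  let ?u = "scale k (idem V1) + idem V2" and ?v = "scale (inverse k) (idem V1) + idem V2"
  have vu: "?v * ?u = 1"
    using k by (simp add: algebra_simps idem_mult one_palg_def)
  then show "alg_hom_to (*) scale (\<lambda>f. ?u * f * ?v)" by (rule alg_hom_inner)
  show "\<zeta> (idem u) = ?u * idem u * ?v" for u
    using assms(1) k by (cases u) (simp_all add: alg_aut_def algebra_simps idem_mult)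
  show "\<zeta> (arr r) = ?u * arr r * ?v" for r
    using assms(2) k
    by (cases r) (simp_all add: Z_scales_def algebra_simps idem_arr arr_idem del: tgt.simps, simp_all)
qed

lemma Z_central:
  assumes "\<phi> \<in> carrier Aut_c" "\<zeta> \<in> Z_sub"
  shows "\<phi> \<circ> \<zeta> = \<zeta> \<circ> \<phi>"
proof
  fix f
  obtain k where k: "alg_aut \<zeta>" "Z_scales k \<zeta>"
    using assms(2) by (auto simp: Z_sub_iff Aut_c_def)
  have \<phi>: "alg_hom_to (*) scale \<phi>" "\<And>u. \<phi> (idem u) = idem u"
    using assms(1) alg_aut_hom by (auto simp: Aut_c_def alg_aut_def)
  show "(\<phi> \<circ> \<zeta>) f = (\<zeta> \<circ> \<phi>) f"
    unfolding o_apply Z_scales_inner[OF k] by (simp only: alg_hom_toD[OF \<phi>(1)] \<phi>(2))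
qed

lemma Z_normal: "Z_sub \<lhd> TAut_c"
proof -
  interpret A: group Aut_c by (rule group_Aut_c)
  interpret T: group TAut_c by (rule group_TAut_c)
  have sub: "subgroup Z_sub Aut_c"
  proof (rule A.subgroupI)
    show "Z_sub \<subseteq> carrier Aut_c" by (auto simp: Z_sub_iff)
    have "Z_scales 1 id" by (simp add: Z_scales_def)
    moreover have "id \<in> carrier Aut_c" using A.one_closed by (simp add: Aut_c_def)
    ultimately have "id \<in> Z_sub" by (auto simp: Z_sub_iff)
    then show "Z_sub \<noteq> {}" by blast
  next
    fix \<zeta> assume \<zeta>: "\<zeta> \<in> Z_sub"
    then obtain k where k: "Z_scales k \<zeta>" and c: "\<zeta> \<in> carrier Aut_c" by (auto simp: Z_sub_iff)
    let ?\<eta> = "inv\<^bsub>Aut_c\<^esub> \<zeta>"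
    have \<eta>: "?\<eta> \<in> carrier Aut_c" using c by simp
    then have h: "alg_hom_to (*) scale ?\<eta>" by (simp add: Aut_c_def alg_aut_hom)
    have "?\<eta> \<circ> \<zeta> = id" using A.l_inv[OF c] by (simp add: Aut_c_def)
    then have e: "?\<eta> (\<zeta> f) = f" for f by (simp add: fun_eq_iff)
    have s: "?\<eta> f = scale (inverse l) f" if "\<zeta> f = scale l f" "l \<noteq> 0" for l f
    proof -
      have "scale l (?\<eta> f) = f" using e[of f] that by (simp add: alg_hom_toD[OF h])
      then have "scale (inverse l) (scale l (?\<eta> f)) = scale (inverse l) f" by simp
      then show ?thesis using that by simp
    qed
    have "Z_scales (inverse k) ?\<eta>"
      using k e[of "arr ar_a"] e[of "arr ar_as"] s[of "arr ar_x" k] s[of "arr ar_ys" k]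
        s[of "arr ar_xs" "inverse k"] s[of "arr ar_y" "inverse k"]
      by (simp add: Z_scales_def del: tgt.simps)
    with \<eta> show "?\<eta> \<in> Z_sub" by (auto simp: Z_sub_iff)
  next
    fix \<zeta> \<eta> assume "\<zeta> \<in> Z_sub" "\<eta> \<in> Z_sub"
    then obtain k l where k: "Z_scales k \<zeta>" "\<zeta> \<in> carrier Aut_c"
      and l: "Z_scales l \<eta>" "\<eta> \<in> carrier Aut_c" by (auto simp: Z_sub_iff)
    have h: "alg_hom_to (*) scale \<zeta>" using k by (simp add: Aut_c_def alg_aut_hom)
    have "Z_scales (l * k) (\<zeta> \<circ> \<eta>)"
      using k l by (simp add: Z_scales_def alg_hom_toD[OF h] del: tgt.simps)
    then show "\<zeta> \<otimes>\<^bsub>Aut_c\<^esub> \<eta> \<in> Z_sub"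
      using A.m_closed[OF k(2) l(2)] by (auto simp: Z_sub_iff Aut_c_def)
  qed
  have "Z_sub \<subseteq> {\<phi> \<in> carrier Aut_c. strictly_triangular \<phi>} \<union> {\<phi> \<in> carrier Aut_c. affine_aut \<phi>}"
    by (auto simp: Z_sub_def)
  then have "subgroup Z_sub TAut_c"
    unfolding TAut_c_def using sub by (rule A.subgroup_of_subgroup_generated)
  moreover have "\<phi> \<otimes>\<^bsub>TAut_c\<^esub> \<zeta> \<otimes>\<^bsub>TAut_c\<^esub> inv\<^bsub>TAut_c\<^esub> \<phi> \<in> Z_sub"
    if \<phi>: "\<phi> \<in> carrier TAut_c" and \<zeta>: "\<zeta> \<in> Z_sub" for \<phi> \<zeta>
  proof -
    have z: "\<zeta> \<in> carrier TAut_c" using \<zeta> by (intro TAut_c_carrier) (auto simp: Z_sub_def)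
    have "\<phi> \<otimes>\<^bsub>TAut_c\<^esub> \<zeta> = \<zeta> \<otimes>\<^bsub>TAut_c\<^esub> \<phi>"
      using Z_central[OF TAut_c_Aut_c[OF \<phi>] \<zeta>] by (simp add: TAut_c_ops)
    then show ?thesis using \<phi> z \<zeta> by (simp add: T.m_assoc)
  qed
  ultimately show ?thesis by (simp add: T.normal_inv_iff)
qed

definition cls :: "(palg \<Rightarrow> palg) \<Rightarrow> (palg \<Rightarrow> palg) set" where
  "cls \<phi> = Z_sub #>\<^bsub>TAut_c\<^esub> \<phi>"

lemma cls_eq: "cls \<phi> = {\<zeta> \<circ> \<phi> | \<zeta>. \<zeta> \<in> Z_sub}"
  by (auto simp: cls_def r_coset_def TAut_c_ops)

lemma group_PTAut_c: "group PTAut_c"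
  unfolding PTAut_c_def by (rule normal.factorgroup_is_group[OF Z_normal])

lemma cls_hom: "cls \<in> hom TAut_c PTAut_c"
  unfolding cls_def[abs_def] PTAut_c_def by (rule normal.r_coset_hom_Mod[OF Z_normal])

lemma PTAut_c_carrier: "carrier PTAut_c = cls ` carrier TAut_c"
  by (auto simp: PTAut_c_def FactGroup_def RCOSETS_def cls_def)

lemma F_class_eq: "F_class = cls (arrow_subst F_gen)"
  by (simp add: F_class_def cls_def)

section \<open>The homomorphism from the group of matrix-valued functions\<close>

text \<open>Differentiating the constant function exp r gives exp r * r' = 0, so r' vanishes
  everywhere and r is constant.\<close>

lemma exp_poly_eq_1:
  fixes r :: "complex poly"
  assumes e: "\<And>z. exp (poly r z) = 1" and 0: "coeff r 0 = 0"
  shows "r = 0"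
proof -
  have "poly (pderiv r) z = 0" for z
  proof -
    have "((\<lambda>z. exp (poly r z)) has_field_derivative exp (poly r z) * poly (pderiv r) z) (at z)"
      by (rule DERIV_fun_exp[OF poly_DERIV])
    moreover have "((\<lambda>z. exp (poly r z)) has_field_derivative 0) (at z)"
      unfolding e by (rule DERIV_const)
    ultimately have "exp (poly r z) * poly (pderiv r) z = 0" by (rule DERIV_unique)
    then show ?thesis by (simp only: e mult_1)
  qed
  then have "pderiv r = 0" using poly_all_0_iff_0[of "pderiv r"] by blast
  then obtain c where "r = [:c:]" by (auto simp: pderiv_eq_0_iff elim: degree_eq_zeroE)
  with 0 show ?thesis by simp
qed

lemma exp_poly_inj:
  assumes "\<And>z :: complex. exp (poly p z) = exp (poly q z)" "coeff p 0 = coeff q 0"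
  shows "p = q"
proof -
  have "exp (poly (p - q) z) = 1" for z
    using assms(1)[of z] by (simp add: exp_diff)
  then have "p - q = 0" by (rule exp_poly_eq_1) (simp add: assms(2))
  then show ?thesis by simp
qed

text \<open>Used with r = 1 and r = 2: the indices 1, 3, 5, ... and 2, 4, 6, ... partition the
  positive integers and skip the constant coefficient, which vanishes for exponents of
  \<open>Gamma_sc\<close>.\<close>

lift_definition decimate :: "nat \<Rightarrow> complex poly \<Rightarrow> complex poly" is "\<lambda>r p k. p (2 * k + r)"
proof -
  fix r :: nat and p :: "nat \<Rightarrow> complex"
  assume "\<forall>\<^sub>\<infinity>n. p n = 0"
  then show "\<forall>\<^sub>\<infinity>n. p (2 * n + r) = 0"
    by (rule MOST_inj) (auto simp: inj_on_def)
qed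

lemma coeff_decimate: "coeff (decimate r p) k = coeff p (2 * k + r)"
  by transfer simp

lemma decimate_add: "decimate r (p + q) = decimate r p + decimate r q"
  by (rule poly_eqI) (simp add: coeff_decimate)

lemma decimate_surj: "\<exists>p. coeff p 0 = 0 \<and> decimate 1 p = P \<and> decimate 2 p = Q"
proof -
  let ?f = "\<lambda>n. if n = 0 then 0 else if odd n then coeff P (n div 2) else coeff Q (n div 2 - 1)"
  \<comment> \<open>For n beyond this bound both n div 2 and n div 2 - 1 exceed the degrees, so the
    truncated list loses no coefficient.\<close>
  let ?N = "2 * max (degree P) (degree Q) + 4"
  let ?p = "Poly (map ?f [0..<?N])"
  have c: "coeff ?p n = ?f n" for n
  proof (cases "n < ?N")
    case False
    then have "degree P < n div 2" "degree Q < n div 2 - 1" by auto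
    then show ?thesis using False by (auto simp: coeff_Poly_eq nth_default_def coeff_eq_0)
  qed (auto simp: coeff_Poly_eq nth_default_def)
  show ?thesis
    by (rule exI[of _ ?p]) (auto intro!: poly_eqI simp: coeff_decimate c simp del: coeff_Poly_eq)
qed

text \<open>The exponential determines its exponent up to a constant in 2 pi i Z; the condition on
  the constant coefficient removes this ambiguity.\<close>

definition log_poly :: "(complex \<Rightarrow> complex ^ 2 ^ 2) \<Rightarrow> complex poly" where
  "log_poly f = (THE p. coeff p 0 = 0 \<and> f = (\<lambda>z. mat (exp (poly p z))))"

lemma mat_inj: "(mat c :: 'a::zero ^ 'n ^ 'n) = mat d \<longleftrightarrow> c = d"
proof
  assume "(mat c :: 'a ^ 'n ^ 'n) = mat d"
  from arg_cong[OF this, of "\<lambda>M. M $ undefined $ undefined"] show "c = d" by (simp add: mat_def)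
qed simp

lemma mat_mult: "(mat c :: complex ^ 'n ^ 'n) ** mat d = mat (c * d)"
  by (simp add: vec_eq_iff matrix_matrix_mult_def mat_def if_distrib[where f = "\<lambda>x. x * _"] cong: if_cong)

lemma log_poly:
  assumes "coeff p 0 = 0"
  shows "log_poly (\<lambda>z. mat (exp (poly p z))) = p"
  unfolding log_poly_def
proof (rule the_equality)
  fix q assume q: "coeff q 0 = 0 \<and>
    (\<lambda>z. mat (exp (poly p z)) :: complex ^ 2 ^ 2) = (\<lambda>z. mat (exp (poly q z)))"
  show "q = p"
  proof (rule exp_poly_inj)
    show "exp (poly q z) = exp (poly p z)" for z
      using fun_cong[OF conjunct2[OF q], of z] by (simp add: mat_inj)
  qed (use q assms in simp)
qed (simp add: assms)

text \<open>The strictly triangular group is abelian, and the additive group of polynomials without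
  constant term is isomorphic to the group of pairs $(P, Q)$, by taking odd and even coefficients.
  So $\Gamma^{\mathrm{alg}}_{\mathrm{sc}}$ already maps onto the automorphisms \<^const>\<open>tri\<close> \<open>P Q\<close>,
  and the homomorphism can be taken trivial on $\mathrm{PGL}_2(\mathbb{C}[z])$.\<close>

definition Gamma_hom :: "(complex \<Rightarrow> complex ^ 2 ^ 2) \<times> (complex poly ^ 2 ^ 2) set \<Rightarrow> (palg \<Rightarrow> palg) set" where
  "Gamma_hom g = cls (tri (decimate 1 (log_poly (fst g))) (decimate 2 (log_poly (fst g))))"

lemma Gamma_hom: "Gamma_hom \<in> hom Gamma_alg PTAut_c"
proof (rule homI)
  show "Gamma_hom g \<in> carrier PTAut_c" for g
    by (simp add: Gamma_hom_def PTAut_c_carrier tri_TAut_c)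
  fix g h assume "g \<in> carrier Gamma_alg" "h \<in> carrier Gamma_alg"
  then obtain p q where p: "fst g = (\<lambda>z. mat (exp (poly p z)))" "coeff p 0 = 0"
    and q: "fst h = (\<lambda>z. mat (exp (poly q z)))" "coeff q 0 = 0"
    by (auto simp: Gamma_alg_def Gamma_sc_def DirProd_def)
  have "fst (g \<otimes>\<^bsub>Gamma_alg\<^esub> h) = (\<lambda>z. mat (exp (poly (p + q) z)))"
    using p q by (cases g; cases h) (simp add: Gamma_alg_def Gamma_sc_def mat_mult exp_add)
  then have "Gamma_hom (g \<otimes>\<^bsub>Gamma_alg\<^esub> h) =
      cls (tri (decimate 1 p) (decimate 2 p) \<otimes>\<^bsub>TAut_c\<^esub> tri (decimate 1 q) (decimate 2 q))"
    using p q by (simp only: Gamma_hom_def log_poly coeff_add add_0 decimate_add TAut_c_ops tri_tri)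
  also have "\<dots> = Gamma_hom g \<otimes>\<^bsub>PTAut_c\<^esub> Gamma_hom h"
    using p q by (simp add: hom_mult[OF cls_hom tri_TAut_c tri_TAut_c] Gamma_hom_def log_poly)
  finally show "Gamma_hom (g \<otimes>\<^bsub>Gamma_alg\<^esub> h) = Gamma_hom g \<otimes>\<^bsub>PTAut_c\<^esub> Gamma_hom h" .
qed

lemma Gamma_hom_image: "cls (tri P Q) \<in> Gamma_hom ` carrier Gamma_alg"
proof -
  obtain p where p: "coeff p 0 = 0" "decimate 1 p = P" "decimate 2 p = Q"
    using decimate_surj by blast
  let ?H = "{mat [:k:] | k :: complex. k \<noteq> 0} #>\<^bsub>GL2_poly\<^esub> mat 1"
  let ?g = "(\<lambda>z. mat (exp (poly p z)) :: complex ^ 2 ^ 2, ?H)"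
  have "invertible (mat 1 :: complex poly ^ 2 ^ 2)"
    unfolding invertible_def by (rule exI[of _ "mat 1"]) simp
  then have "?H \<in> carrier PGL2_poly"
    by (auto simp: PGL2_poly_def FactGroup_def RCOSETS_def GL2_poly_def)
  moreover have "fst ?g \<in> carrier Gamma_sc" using p(1) by (auto simp: Gamma_sc_def)
  ultimately have g: "?g \<in> carrier Gamma_alg" by (simp add: Gamma_alg_def DirProd_def)
  have "cls (tri P Q) = Gamma_hom ?g" using p by (simp add: Gamma_hom_def log_poly)
  then show ?thesis using g by (rule image_eqI)
qed

section \<open>Evaluation at representations\<close>

definition mscale :: "complex \<Rightarrow> complex ^ 'n ^ 'm \<Rightarrow> complex ^ 'n ^ 'm" where
  "mscale k M = (\<chi> i j. k * M $ i $ j)"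

lemma sum_UNIV_Plus:
  "(\<Sum>k\<in>(UNIV :: ('n::finite + 1) set). f k) = (\<Sum>k\<in>UNIV. f (Inl k)) + f (Inr 1)"
  by (simp add: UNIV_Plus_UNIV[symmetric] sum.Plus del: UNIV_Plus_UNIV)

lemma matrix_add_mult: "(A + B) ** C = A ** C + B ** C"
  for A B :: "'a::semiring_1 ^ 'n ^ 'm"
  by (simp add: matrix_matrix_mult_def vec_eq_iff distrib_right sum.distrib)

lemma matrix_mult_uminus: "A ** (- B) = - (A ** B)" "(- A) ** B = - (A ** B)"
  for A :: "'a::ring_1 ^ 'n ^ 'm"
  by (simp_all add: matrix_matrix_mult_def vec_eq_iff sum_negf)

lemma matrix_inv:
  assumes "invertible A"
  shows "A ** matrix_inv A = mat 1" "matrix_inv A ** A = mat 1"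
  using someI_ex[OF assms[unfolded invertible_def]] by (simp_all add: matrix_inv_def)

text \<open>The matrix diag(g, 1): it turns the base change at vertex 1 into a conjugation of the
  full (n+1)-square matrices.\<close>

definition gblock :: "complex ^ 'n ^ 'n \<Rightarrow> complex ^ ('n + 1) ^ ('n::finite + 1)" where
  "gblock g = block11 g + block22 (mat 1)"

lemmas block_simps = vec_eq_iff matrix_matrix_mult_def sum_UNIV_Plus split_sum_all mscale_def
  block11_def block12_def block21_def block22_def get11_def get12_def get21_def gblock_def mat_def
  if_distrib[where f = "\<lambda>x. x * _"] if_distrib[where f = "\<lambda>x. _ * x"]

lemma block_vertex_mult [simp]:
  "block11 (mat 1) ** block11 A = block11 A" "block11 A ** block11 (mat 1) = block11 A"
  "block11 (mat 1) ** block12 B = block12 B" "block12 B ** block22 (mat 1) = block12 B"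
  "block22 (mat 1) ** block21 C = block21 C" "block21 C ** block11 (mat 1) = block21 C"
  "block22 (mat 1) ** block22 D = block22 D"
  "block11 (mat 1) ** block22 D = 0" "block22 D ** block11 (mat 1) = 0"
  by (simp_all add: block_simps cong: if_cong)

lemma vertex_compress:
  "block11 (mat 1) ** M ** block11 (mat 1) = block11 (get11 M)"
  "block11 (mat 1) ** M ** block22 (mat 1) = block12 (get12 M)"
  "block22 (mat 1) ** M ** block11 (mat 1) = block21 (get21 M)"
  by (simp_all add: block_simps cong: if_cong)

lemma get_block [simp]: "get11 (block11 A) = A" "get12 (block12 B) = B" "get21 (block21 C) = C"
  by (simp_all add: block_simps)

lemma gblock_mult:
  "gblock g ** gblock h = gblock (g ** h)"
  "gblock g ** block11 A ** gblock h = block11 (g ** A ** h)"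
  "gblock g ** block12 B ** gblock h = block12 (g ** B)"
  "gblock g ** block21 C ** gblock h = block21 (C ** h)"
  "gblock g ** block22 D ** gblock h = block22 D"
  "get11 (gblock g ** M ** gblock h) = g ** get11 M ** h"
  "get12 (gblock g ** M ** gblock h) = g ** get12 M"
  "get21 (gblock g ** M ** gblock h) = get21 M ** h"
  by (simp_all add: block_simps cong: if_cong)

lemma gblock_1: "gblock (mat 1) = mat 1"
  by (simp add: block_simps)

lemma arrow_mat_path_target:
  fixes p :: "'n::finite rep"
  shows "path_target (**) mscale vertex_mat (arrow_mat p)"
proof unfold_locales
  show "(L ** M) ** N = L ** (M ** N)" "L ** (M + N) = L ** M + L ** N" "(L + M) ** N = L ** N + M ** N"
    for L M N :: "complex ^ ('n + 1) ^ ('n + 1)"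
    by (rule matrix_mul_assoc[symmetric] matrix_add_ldistrib matrix_add_mult)+
  show "vertex_mat (tgt r) ** arrow_mat p r = arrow_mat p r"
    "arrow_mat p r ** vertex_mat (src r) = arrow_mat p r" for r
    by (cases p; cases r; simp)+
  show "vertex_mat u ** vertex_mat v = (if u = v then vertex_mat u else 0)" for u v
    by (cases u; cases v; simp)
qed (simp_all add: vec_eq_iff matrix_matrix_mult_def mscale_def algebra_simps sum_distrib_left)

lemma eval_at_hom: "alg_hom_to (**) mscale (eval_at p)"
  and eval_at_idem [simp]: "eval_at p (idem u) = vertex_mat u"
  and eval_at_arr: "eval_at p (arr r) = arrow_mat p r"
proof -
  interpret path_target "(**)" mscale vertex_mat "arrow_mat p" by (rule arrow_mat_path_target)
  have pm: "path_mat p u l = pm u l" for u l by (induction l arbitrary: u) simp_all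
  have "eval_at p f = lift_hom f" for f
    by (simp add: eval_at_def lift_hom_def vec_eq_iff pm mscale_def case_prod_beta')
  then have eq: "eval_at p = lift_hom" by auto
  show "alg_hom_to (**) mscale (eval_at p)" unfolding eq by (rule alg_hom_lift_hom)
  show "eval_at p (idem u) = vertex_mat u" by (simp add: eq lift_hom_basis)
  show "eval_at p (arr r) = arrow_mat p r"
    by (simp add: eq lift_hom_basis R_E)
qed

text \<open>\<open>rep_act\<close> keeps one block of each evaluated arrow. Nothing is lost, because
  an automorphism fixing e1 and e2 maps every arrow into its own Peirce block.\<close>

lemma arrow_mat_rep_act:
  assumes "alg_aut \<phi>"
  shows "arrow_mat (rep_act \<phi> p) r = eval_at p (\<phi> (arr r))"
proof -
  let ?M = "eval_at p (\<phi> (arr r))"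
  have "?M = eval_at p (idem (tgt r) * \<phi> (arr r) * idem (src r))"
    using alg_aut_block[OF assms] by simp
  also have "\<dots> = vertex_mat (tgt r) ** ?M ** vertex_mat (src r)"
    by (simp add: alg_hom_toD[OF eval_at_hom])
  also have "\<dots> = arrow_mat (rep_act \<phi> p) r"
    by (cases r) (simp_all add: rep_act_def vertex_compress)
  finally show ?thesis ..
qed

lemma eval_at_rep_act:
  assumes "alg_aut \<phi>"
  shows "eval_at (rep_act \<phi> p) f = eval_at p (\<phi> f)"
proof (rule alg_hom_to_eqI[OF eval_at_hom alg_hom_comp[OF eval_at_hom alg_aut_hom[OF assms]]])
  show "eval_at (rep_act \<phi> p) (idem u) = eval_at p (\<phi> (idem u))" for u
    using assms by (simp add: alg_aut_def)
  show "eval_at (rep_act \<phi> p) (arr r) = eval_at p (\<phi> (arr r))" for r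
    by (simp only: eval_at_arr arrow_mat_rep_act[OF assms])
qed

lemma of_rep_to_rep [simp]: "of_rep (to_rep q) = q"
  using exhaust_2 by (cases q) (auto simp: of_rep_def to_rep_def vec_eq_iff)

lemma to_rep_of_rep [simp]: "to_rep (of_rep p) = p"
  by (cases p) (auto simp: of_rep_def to_rep_def vec_eq_iff)

text \<open>Evaluating \<phi>(\<psi>(r)) at p is evaluating \<psi>(r) at the point moved by \<phi>.
  Automorphisms thus act from the right: the left factor of a product acts first.\<close>

lemma rep_act_comp: "alg_aut \<phi> \<Longrightarrow> rep_act (\<phi> \<circ> \<psi>) p = rep_act \<psi> (rep_act \<phi> p)"
  by (subst (1 2) rep_act_def) (simp add: eval_at_rep_act)

lemma quad_act_comp: "alg_aut \<phi> \<Longrightarrow> quad_act (\<phi> \<circ> \<psi>) q = quad_act \<psi> (quad_act \<phi> q)"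
  by (simp add: quad_act_def rep_act_comp)

lemma rep_act_id: "rep_act id p = p"
  by (cases p) (simp add: rep_act_def eval_at_arr del: tgt.simps)

lemma quad_act_id: "quad_act id q = q"
  by (simp add: quad_act_def rep_act_id)

text \<open>At vertex 1 the element c evaluates to [X,Y] + X_1 Y_2 - X_2 Y_1, and the sign in X_2 =
  - v_2 turns this into [X,Y] + vw. Automorphisms fixing c therefore preserve the moment
  map.\<close>

lemma moment_eval: "moment q = get11 (eval_at (to_rep q) c_elem)"
proof (cases q)
  case (fields X Y v w)
  show ?thesis
    unfolding fields c_elem_def commutator_def
    by (simp only: alg_hom_toD[OF eval_at_hom] eval_at_arr to_rep_def prod.case arrow_mat.simps)
      (simp add: moment_def block_simps UNIV_2 algebra_simps)
qed

lemma moment_quad_act: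
  assumes "\<phi> \<in> carrier Aut_c"
  shows "moment (quad_act \<phi> q) = moment q"
  using assms by (simp add: moment_eval quad_act_def eval_at_rep_act Aut_c_def)

definition rep_gl :: "complex ^ 'n ^ 'n \<Rightarrow> 'n::finite rep \<Rightarrow> 'n rep" where
  "rep_gl g = (\<lambda>(A0, B0, X1, X2, Y1, Y2). (g ** A0 ** matrix_inv g, g ** B0 ** matrix_inv g,
    g ** X1, g ** X2, Y1 ** matrix_inv g, Y2 ** matrix_inv g))"

lemma to_rep_gl_act: "to_rep (gl_act g q) = rep_gl g (to_rep q)"
  by (cases q) (simp add: to_rep_def gl_act_def rep_gl_def vec_eq_iff matrix_matrix_mult_def
      sum_negf)

lemma eval_at_rep_gl:
  assumes "invertible g"
  shows "eval_at (rep_gl g p) f = gblock g ** eval_at p f ** gblock (matrix_inv g)"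
proof (rule alg_hom_to_eqI[OF eval_at_hom])
  let ?G = "gblock g" and ?H = "gblock (matrix_inv g)"
  have i: "matrix_inv g ** g = mat 1" "g ** matrix_inv g = mat 1"
    using assms by (simp_all add: matrix_inv)
  then have HG: "?H ** ?G = mat 1" by (simp add: gblock_mult gblock_1)
  have "?G ** (M ** N) ** ?H = (?G ** M ** ?H) ** (?G ** N ** ?H)" for M N
  proof -
    have "(?G ** M ** ?H) ** (?G ** N ** ?H) = ?G ** M ** (?H ** ?G) ** N ** ?H"
      by (simp only: matrix_mul_assoc)
    then show ?thesis by (simp add: HG matrix_mul_assoc)
  qed
  moreover have "?G ** mscale k M ** ?H = mscale k (?G ** M ** ?H)" for k M
    by (simp add: vec_eq_iff matrix_matrix_mult_def mscale_def sum_distrib_left sum_distrib_right mult_ac)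
  ultimately show "alg_hom_to (**) mscale (\<lambda>f. ?G ** eval_at p f ** ?H)"
    by (simp add: alg_hom_to_def alg_hom_toD[OF eval_at_hom] matrix_add_ldistrib matrix_add_mult)
  show "eval_at (rep_gl g p) (idem u) = ?G ** eval_at p (idem u) ** ?H" for u
    by (cases u) (simp_all add: gblock_mult i)
  show "eval_at (rep_gl g p) (arr r) = ?G ** eval_at p (arr r) ** ?H" for r
    unfolding eval_at_arr by (cases p; cases r) (simp_all add: gblock_mult rep_gl_def)
qed

lemma rep_act_rep_gl: "invertible g \<Longrightarrow> rep_act \<phi> (rep_gl g p) = rep_gl g (rep_act \<phi> p)"
  unfolding rep_act_def eval_at_rep_gl gblock_mult by (simp add: rep_gl_def)

lemma quad_act_gl_act:
  assumes "invertible g"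
  shows "quad_act \<phi> (gl_act g q) = gl_act g (quad_act \<phi> q)"
proof -
  have "to_rep (gl_act g (quad_act \<phi> q)) = rep_gl g (rep_act \<phi> (to_rep q))"
    by (simp add: quad_act_def to_rep_gl_act)
  then show ?thesis
    by (metis of_rep_to_rep quad_act_def rep_act_rep_gl[OF assms] to_rep_gl_act)
qed

section \<open>Orbits and the action of classes\<close>

definition orb :: "'n::finite quad \<Rightarrow> 'n quad set" where
  "orb q = {gl_act g q | g. invertible g}"

lemma matrix_inv_eqI:
  fixes g h :: "complex ^ 'n::finite ^ 'n"
  assumes "g ** h = mat 1"
  shows "invertible g" "matrix_inv g = h"
proof -
  have "h ** g = mat 1" using assms matrix_left_right_inverse by blast
  with assms show inv: "invertible g" by (auto simp: invertible_def)
  have "matrix_inv g = matrix_inv g ** (g ** h)" by (simp add: assms)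
  also have "\<dots> = h" using inv by (simp add: matrix_mul_assoc matrix_inv)
  finally show "matrix_inv g = h" .
qed

lemma gl_act_1: "gl_act (mat 1) q = q"
  by (cases q) (simp add: gl_act_def matrix_inv_eqI(2)[of "mat 1" "mat 1"])

lemma gl_act_gl_act:
  assumes "invertible g" "invertible h"
  shows "gl_act g (gl_act h q) = gl_act (g ** h) q"
proof -
  have "(g ** h) ** (matrix_inv h ** matrix_inv g) = g ** (h ** matrix_inv h) ** matrix_inv g"
    by (simp only: matrix_mul_assoc)
  then have "matrix_inv (g ** h) = matrix_inv h ** matrix_inv g"
    using assms by (intro matrix_inv_eqI(2)) (simp add: matrix_inv)
  then show ?thesis by (cases q) (simp add: gl_act_def matrix_mul_assoc)
qed

lemma orb_gl_act:
  assumes h: "invertible h"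
  shows "orb (gl_act h q) = orb q"
proof
  show "orb (gl_act h q) \<subseteq> orb q"
    using h by (auto simp: orb_def gl_act_gl_act intro: invertible_mult)
  show "orb q \<subseteq> orb (gl_act h q)"
  proof
    fix q' assume "q' \<in> orb q"
    then obtain g where g: "invertible g" "q' = gl_act g q" by (auto simp: orb_def)
    have i: "matrix_inv h ** h = mat 1" "h ** matrix_inv h = mat 1" using h by (simp_all add: matrix_inv)
    then have j: "invertible (matrix_inv h)" by (auto simp: invertible_def)
    have "gl_act (g ** matrix_inv h) (gl_act h q) = q'"
      using g h j i by (simp add: gl_act_gl_act invertible_mult matrix_mul_assoc[symmetric])
    then show "q' \<in> orb (gl_act h q)" using invertible_mult[OF g(1) j] by (auto simp: orb_def)
  qed
qed

lemma C_var_orb: "\<xi> \<in> C_var \<tau> \<longleftrightarrow> (\<exists>q\<in>level \<tau>. \<xi> = orb q)"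
  by (auto simp: C_var_def quotient_def orb_def Image_def)

text \<open>Multiplying v by k and w by 1/k is the base change by the scalar matrix k, under which X
  and Y do not move.\<close>

lemma quad_act_Z:
  assumes "\<zeta> \<in> Z_sub"
  obtains k where "invertible (mat k :: complex ^ 'n ^ 'n)"
    "\<And>q :: 'n::finite quad. quad_act \<zeta> q = gl_act (mat k) q"
proof -
  obtain k where k: "Z_scales k \<zeta>" using assms by (auto simp: Z_sub_iff)
  then have k0: "k \<noteq> 0" by (simp add: Z_scales_def)
  let ?m = "mat k :: complex ^ 'n ^ 'n"
  have "?m ** mat (inverse k) = mat 1" using k0 by (simp add: mat_mult)
  note inv = matrix_inv_eqI[OF this]
  have mm: "mat c ** M = mscale c M" "M ** mat c = mscale c M"
    for c and M :: "complex ^ 'm::finite ^ 'l::finite"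
    by (simp_all add: vec_eq_iff matrix_matrix_mult_def mat_def mscale_def mult.commute
        if_distrib[where f = "\<lambda>x. x * _"] if_distrib[where f = "\<lambda>x. _ * x"] cong: if_cong)
  have g: "get12 (mscale c M) = mscale c (get12 M)" "get21 (mscale c M) = mscale c (get21 M)"
    for c and M :: "complex ^ ('n + 1) ^ ('n + 1)"
    by (simp_all add: get12_def get21_def mscale_def vec_eq_iff)
  have s: "mscale k (mscale (inverse k) M) = M" "mscale (inverse k) (mscale k M) = M" for M :: "complex ^ 'n ^ 'n"
    using k0 by (simp_all add: mscale_def vec_eq_iff)
  have "rep_act \<zeta> p = rep_gl ?m p" for p
    using k unfolding rep_act_def Z_scales_def
    by (cases p) (simp add: alg_hom_toD[OF eval_at_hom] eval_at_arr rep_gl_def inv mm g s del: tgt.simps)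
  then have "quad_act \<zeta> q = gl_act ?m q" for q
    by (metis of_rep_to_rep quad_act_def to_rep_gl_act)
  with inv(1) show thesis by (rule that)
qed

text \<open>Other representatives differ from \<phi> by an element of \<open>Z_sub\<close>, which
  acts through \<open>gl_act\<close>, and \<open>quad_act\<close> commutes with
  \<open>gl_act\<close>. So the union defining \<open>PT_act\<close> is a single orbit.\<close>

lemma PT_act_cls:
  fixes q :: "'n::finite quad"
  assumes "\<phi> \<in> carrier TAut_c"
  shows "PT_act (cls \<phi>) (orb q) = orb (quad_act \<phi> q)"
proof
  have aut: "alg_aut \<zeta>" if "\<zeta> \<in> Z_sub" for \<zeta> using that by (simp add: Z_sub_iff Aut_c_def)
  show "PT_act (cls \<phi>) (orb q) \<subseteq> orb (quad_act \<phi> q)"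
  proof
    fix q' assume "q' \<in> PT_act (cls \<phi>) (orb q)"
    then obtain \<zeta> g where z: "\<zeta> \<in> Z_sub" and g: "invertible g" and q': "q' = quad_act (\<zeta> \<circ> \<phi>) (gl_act g q)"
      by (auto simp: PT_act_def cls_eq orb_def)
    obtain k where k: "invertible (mat k :: complex ^ 'n ^ 'n)"
      "\<And>q :: 'n quad. quad_act \<zeta> q = gl_act (mat k) q" using quad_act_Z[OF z] by blast
    have "q' = gl_act (mat k ** g) (quad_act \<phi> q)"
      by (simp add: q' quad_act_comp[OF aut[OF z]] k quad_act_gl_act invertible_mult g gl_act_gl_act)
    then show "q' \<in> orb (quad_act \<phi> q)" using invertible_mult[OF k(1) g] by (auto simp: orb_def)
  qed
  show "orb (quad_act \<phi> q) \<subseteq> PT_act (cls \<phi>) (orb q)"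
  proof
    fix q' assume "q' \<in> orb (quad_act \<phi> q)"
    then obtain g where g: "invertible g" "q' = quad_act \<phi> (gl_act g q)"
      by (auto simp: orb_def quad_act_gl_act)
    have "\<phi> \<in> cls \<phi>"
      using subgroup.one_closed[OF normal_imp_subgroup[OF Z_normal]]
      by (auto simp: cls_eq TAut_c_ops intro!: exI[of _ id])
    with g show "q' \<in> PT_act (cls \<phi>) (orb q)" by (auto simp: PT_act_def orb_def)
  qed
qed

section \<open>The generated group and its orbit relation\<close>

definition trans_group :: "(palg \<Rightarrow> palg) set set" where
  "trans_group = generate PTAut_c (Gamma_hom ` carrier Gamma_alg \<union> {F_class})"

lemma trans_group_gens: "Gamma_hom ` carrier Gamma_alg \<union> {F_class} \<subseteq> carrier PTAut_c"
  using Gamma_hom F_TAut_c by (auto simp: hom_def F_class_eq PTAut_c_carrier)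

lemma trans_group_carrier: "\<Phi> \<in> trans_group \<Longrightarrow> \<exists>\<phi>\<in>carrier TAut_c. \<Phi> = cls \<phi>"
  using group.generate_incl[OF group_PTAut_c trans_group_gens]
  by (auto simp: trans_group_def PTAut_c_carrier)

text \<open>A relation on quadruples rather than on classes, so that chains of moves can be computed
  in coordinates. It contains the base changes.\<close>

definition conn :: "'n::finite quad \<Rightarrow> 'n quad \<Rightarrow> bool" where
  "conn q q' \<longleftrightarrow> (\<exists>\<Phi>\<in>trans_group. PT_act \<Phi> (orb q) = orb q')"

lemma PT_act_mult:
  assumes "\<Phi> \<in> trans_group" "\<Psi> \<in> trans_group"
  shows "PT_act (\<Phi> \<otimes>\<^bsub>PTAut_c\<^esub> \<Psi>) (orb q) = PT_act \<Psi> (PT_act \<Phi> (orb q))"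
proof -
  obtain \<phi> \<psi> where \<phi>: "\<phi> \<in> carrier TAut_c" "\<Phi> = cls \<phi>" and \<psi>: "\<psi> \<in> carrier TAut_c" "\<Psi> = cls \<psi>"
    using assms trans_group_carrier by metis
  have "\<phi> \<circ> \<psi> \<in> carrier TAut_c"
    using monoid.m_closed[OF group.is_monoid[OF group_TAut_c] \<phi>(1) \<psi>(1)] by (simp add: TAut_c_ops)
  moreover have "\<Phi> \<otimes>\<^bsub>PTAut_c\<^esub> \<Psi> = cls (\<phi> \<circ> \<psi>)"
    using hom_mult[OF cls_hom \<phi>(1) \<psi>(1)] \<phi> \<psi> by (simp add: TAut_c_ops)
  moreover have "alg_aut \<phi>" using TAut_c_Aut_c[OF \<phi>(1)] by (simp add: Aut_c_def)
  ultimately show ?thesis using \<phi> \<psi> by (simp add: PT_act_cls quad_act_comp)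
qed

lemma conn_trans [trans]: "conn q q' \<Longrightarrow> conn q' q'' \<Longrightarrow> conn q q''"
  unfolding conn_def using PT_act_mult generate.eng unfolding trans_group_def by metis

lemma conn_gl: "invertible g \<Longrightarrow> conn q (gl_act g q)"
proof -
  assume "invertible g"
  have id: "id \<in> carrier TAut_c"
    using monoid.one_closed[OF group.is_monoid[OF group_TAut_c]] by (simp add: TAut_c_ops)
  have "cls id = \<one>\<^bsub>PTAut_c\<^esub>"
    using hom_one[OF cls_hom group_TAut_c group_PTAut_c] by (simp add: TAut_c_ops)
  then have "cls id \<in> trans_group" by (simp add: trans_group_def generate.one)
  moreover have "PT_act (cls id) (orb q) = orb (gl_act g q)"
    using PT_act_cls[OF id] \<open>invertible g\<close> by (simp add: quad_act_id orb_gl_act)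
  ultimately show ?thesis by (auto simp: conn_def)
qed

lemma conn_sym: "conn q q' \<Longrightarrow> conn q' q"
proof -
  assume "conn q q'"
  then obtain \<Phi> where \<Phi>: "\<Phi> \<in> trans_group" "PT_act \<Phi> (orb q) = orb q'" by (auto simp: conn_def)
  interpret group PTAut_c by (rule group_PTAut_c)
  have inv: "inv\<^bsub>PTAut_c\<^esub> \<Phi> \<in> trans_group"
    using generate_m_inv_closed[OF trans_group_gens] \<Phi> by (simp add: trans_group_def)
  have "\<Phi> \<in> carrier PTAut_c"
    using \<Phi>(1) generate_incl[OF trans_group_gens] by (auto simp: trans_group_def)
  then have "\<Phi> \<otimes>\<^bsub>PTAut_c\<^esub> inv\<^bsub>PTAut_c\<^esub> \<Phi> = \<one>\<^bsub>PTAut_c\<^esub>" by simp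
  also have "\<dots> = cls id" using hom_one[OF cls_hom group_TAut_c group_PTAut_c] by (simp add: TAut_c_ops)
  finally have "PT_act (inv\<^bsub>PTAut_c\<^esub> \<Phi>) (orb q') = PT_act (cls id) (orb q)"
    using PT_act_mult[OF \<Phi>(1) inv, of q] \<Phi>(2) by simp
  also have "id \<in> carrier TAut_c"
    using monoid.one_closed[OF group.is_monoid[OF group_TAut_c]] by (simp add: TAut_c_ops)
  then have "PT_act (cls id) (orb q) = orb q" by (simp add: PT_act_cls quad_act_id)
  finally show ?thesis using inv by (auto simp: conn_def)
qed

lemma conn_tri: "conn q (quad_act (tri P Q) q)"
  unfolding conn_def trans_group_def
  by (intro bexI[where x = "cls (tri P Q)"] PT_act_cls tri_TAut_c generate.incl UnI1 Gamma_hom_image)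

lemma conn_F: "conn q (quad_act (arrow_subst F_gen) q)"
  unfolding conn_def trans_group_def
  by (intro bexI[where x = F_class] generate.incl) (simp_all add: F_class_eq PT_act_cls F_TAut_c)

definition diagm :: "('n \<Rightarrow> complex) \<Rightarrow> complex ^ 'n ^ 'n::finite" where
  "diagm d = (\<chi> i j. if i = j then d i else 0)"

lemma diagm_mult: "(diagm d ** M) $ i $ j = d i * M $ i $ j" "(N ** diagm d) $ k $ l = N $ k $ l * d l"
  by (simp_all add: diagm_def matrix_matrix_mult_def if_distrib[where f = "\<lambda>x. x * _"]
      if_distrib[where f = "\<lambda>x. _ * x"] cong: if_cong)

section \<open>Prescribing the spectrum by a diagonal perturbation\<close>

text \<open>This polydisc is the domain for Brouwer's theorem: the fixed point map is estimated
  entry by entry.\<close>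

lemma compact_entries_le_1:
  "compact {G :: complex ^ 'n::finite ^ 'm::finite. \<forall>i j. norm (G $ i $ j) \<le> 1}" (is "compact ?S")
proof -
  have "norm G \<le> real CARD('m) * real CARD('n)" if "G \<in> ?S" for G
  proof -
    have "norm (G $ i) \<le> real CARD('n)" for i
    proof -
      have "norm (G $ i) \<le> (\<Sum>j\<in>UNIV. norm (G $ i $ j))"
        unfolding norm_vec_def by (rule L2_set_le_sum) simp
      also have "\<dots> \<le> (\<Sum>j\<in>(UNIV :: 'n set). 1)" using that by (intro sum_mono) simp
      finally show ?thesis by simp
    qed
    then have "(\<Sum>i\<in>UNIV. norm (G $ i)) \<le> (\<Sum>i\<in>(UNIV :: 'm set). real CARD('n))"
      by (intro sum_mono)
    moreover have "norm G \<le> (\<Sum>i\<in>UNIV. norm (G $ i))"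
      unfolding norm_vec_def[of G] by (rule L2_set_le_sum) simp
    ultimately show ?thesis by simp
  qed
  then have "bounded ?S" by (rule boundedI)
  moreover have "closed ?S"
    by (intro closed_Collect_all closed_Collect_le continuous_intros)
  ultimately show ?thesis by (simp add: compact_eq_bounded_closed)
qed

lemma convex_entries_le_1:
  "convex {G :: complex ^ 'n::finite ^ 'm::finite. \<forall>i j. norm (G $ i $ j) \<le> 1}"
proof (rule convexI)
  fix F G :: "complex ^ 'n ^ 'm" and u v :: real
  assume F: "F \<in> {G. \<forall>i j. norm (G $ i $ j) \<le> 1}" and G: "G \<in> {G. \<forall>i j. norm (G $ i $ j) \<le> 1}"
    and uv: "0 \<le> u" "0 \<le> v" "u + v = 1"
  have "norm ((u *\<^sub>R F + v *\<^sub>R G) $ i $ j) \<le> 1" for i j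
  proof -
    have "norm ((u *\<^sub>R F + v *\<^sub>R G) $ i $ j) \<le> norm (u *\<^sub>R (F $ i $ j)) + norm (v *\<^sub>R (G $ i $ j))"
      using norm_triangle_ineq[of "u *\<^sub>R (F $ i $ j)" "v *\<^sub>R (G $ i $ j)"] by simp
    also have "\<dots> \<le> u * 1 + v * 1"
      unfolding norm_scaleR abs_of_nonneg[OF uv(1)] abs_of_nonneg[OF uv(2)]
      using F G uv by (intro add_mono mult_left_mono) auto
    finally show ?thesis using uv by simp
  qed
  then show "u *\<^sub>R F + v *\<^sub>R G \<in> {G. \<forall>i j. norm (G $ i $ j) \<le> 1}" by simp
qed

text \<open>For a kernel vector x, the row of its largest coordinate x_i gives |x_i| \<le> |x_i| /
  2, so x = 0.\<close>

lemma invertible_diagonally_dominant: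
  fixes G :: "complex ^ 'n::finite ^ 'n"
  assumes diag: "\<And>i. G $ i $ i = 1"
    and off: "\<And>i j. i \<noteq> j \<Longrightarrow> norm (G $ i $ j) * (2 * real CARD('n)) \<le> 1"
  shows "invertible G"
proof -
  have "x = 0" if x: "G *v x = 0" for x
  proof -
    let ?R = "range (\<lambda>k. norm (x $ k))"
    have "Max ?R \<in> ?R" by (rule Max_in) auto
    then obtain i where m: "Max ?R = norm (x $ i)" by (rule imageE)
    have i: "norm (x $ k) \<le> norm (x $ i)" for k
      unfolding m[symmetric] by (rule Max_ge) auto
    have "0 = (G *v x) $ i" using x by simp
    also have "\<dots> = x $ i + (\<Sum>k\<in>UNIV - {i}. G $ i $ k * x $ k)"
      by (simp add: matrix_vector_mult_def sum.remove[of UNIV i] diag)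
    finally have "norm (x $ i) = norm (\<Sum>k\<in>UNIV - {i}. G $ i $ k * x $ k)"
      by (metis add_eq_0_iff norm_minus_cancel)
    also have "\<dots> \<le> (\<Sum>k\<in>UNIV - {i}. norm (G $ i $ k) * norm (x $ i))"
      by (rule order.trans[OF norm_sum]) (auto intro!: sum_mono mult_left_mono i simp: norm_mult)
    also have "\<dots> \<le> (\<Sum>k\<in>UNIV - {i}. 1 / (2 * real CARD('n)) * norm (x $ i))"
      by (intro sum_mono mult_right_mono) (use off in \<open>auto simp: field_simps\<close>)
    also have "\<dots> \<le> (\<Sum>k\<in>(UNIV :: 'n set). 1 / (2 * real CARD('n)) * norm (x $ i))"
      by (rule sum_mono2) auto
    also have "\<dots> = norm (x $ i) / 2" by simp
    finally have "norm (x $ i) = 0" by simp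
    then have "norm (x $ k) = 0" for k using i[of k] by simp
    then show "x = 0" by (simp add: vec_eq_iff)
  qed
  then show ?thesis
    by (simp add: invertible_left_inverse matrix_left_invertible_ker)
qed

text \<open>For widely separated \<open>e\<close>, normalising the eigenvectors \<open>G\<close> to have unit diagonal turns the
  eigenvalue equation into a fixed point equation for \<open>G\<close>, to which Brouwer's theorem applies.\<close>

lemma diagonal_perturbation_spectrum:
  fixes A :: "complex ^ 'n::finite ^ 'n"
  shows "\<exists>M > 0. \<forall>e :: 'n \<Rightarrow> complex. (\<forall>i j. i \<noteq> j \<longrightarrow> M \<le> norm (e i - e j)) \<longrightarrow>
    (\<exists>y G. invertible G \<and> (A + diagm y) ** G = G ** diagm e)"
proof -
  let ?n = "real CARD('n)"
  \<comment> \<open>A bound for all entries of A G when G has entries in the unit disc; the summand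
    1 keeps it positive when A = 0.\<close>
  define \<alpha> where "\<alpha> = (\<Sum>i\<in>UNIV. \<Sum>j\<in>UNIV. norm (A $ i $ j)) + 1"
  have \<alpha>: "\<alpha> > 0"
    unfolding \<alpha>_def by (intro add_nonneg_pos sum_nonneg) auto
  \<comment> \<open>The threshold is \<alpha> (2n + 1): one \<alpha> compensates r_ii in the
    denominators below, and the remaining 2n \<alpha> makes the off-diagonal entries at most 1 /
    (2n).\<close>
  have "\<exists>y G. invertible G \<and> (A + diagm y) ** G = G ** diagm e"
    if e: "\<forall>i j. i \<noteq> j \<longrightarrow> \<alpha> * (2 * ?n + 1) \<le> norm (e i - e j)" for e :: "'n \<Rightarrow> complex"
  proof -
    let ?S = "{G :: complex ^ 'n ^ 'n. \<forall>i j. norm (G $ i $ j) \<le> 1}"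
    define r where "r G i j = (\<Sum>k\<in>UNIV. A $ i $ k * G $ k $ j)" for G :: "complex ^ 'n ^ 'n" and i j
    \<comment> \<open>With G_ii = 1 the diagonal of the eigenvalue equation forces y_i = e_i - r_ii.
      The entry (i, j) then reads r_ij = (e_j - y_i) G_ij, which is solved for G_ij.\<close>
    define f where "f G = (\<chi> i j. if i = j then 1 else r G i j / (e j - (e i - r G i i)))" for G
    have r: "norm (r G i j) \<le> \<alpha>" if "G \<in> ?S" for G i j
    proof -
      have "norm (r G i j) \<le> (\<Sum>k\<in>UNIV. norm (A $ i $ k) * norm (G $ k $ j))"
        unfolding r_def norm_mult[symmetric] by (rule norm_sum)
      also have "\<dots> \<le> (\<Sum>k\<in>UNIV. norm (A $ i $ k) * 1)"
        using that by (intro sum_mono mult_left_mono) auto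
      also have "\<dots> \<le> (\<Sum>i\<in>UNIV. \<Sum>j\<in>UNIV. norm (A $ i $ j))"
        unfolding mult_1_right
        by (rule member_le_sum[of i UNIV "\<lambda>i. \<Sum>k\<in>UNIV. norm (A $ i $ k)"]) (auto intro: sum_nonneg)
      finally show ?thesis by (simp add: \<alpha>_def)
    qed
    have den: "2 * ?n * \<alpha> \<le> norm (e j - (e i - r G i i))" if G: "G \<in> ?S" and "i \<noteq> j" for G i j
    proof -
      have "norm (e j - e i) \<le> norm (e j - (e i - r G i i)) + norm (r G i i)"
        using norm_triangle_ineq4[of "e j - (e i - r G i i)" "r G i i"] by (simp add: algebra_simps)
      moreover have "\<alpha> * (2 * ?n + 1) \<le> norm (e j - e i)" using e \<open>i \<noteq> j\<close> by simp
      ultimately show ?thesis using r[OF G, of i i] by (simp add: algebra_simps)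
    qed
    have n: "?n > 0" by simp
    have den0: "e j - (e i - r G i i) \<noteq> 0" if "G \<in> ?S" "i \<noteq> j" for G i j
    proof
      assume "e j - (e i - r G i i) = 0"
      then show False using den[OF that] mult_pos_pos[OF \<alpha> n] by simp
    qed
    have off: "norm (f G $ i $ j) * (2 * ?n) \<le> 1" if "G \<in> ?S" "i \<noteq> j" for G i j
    proof -
      have "norm (r G i j) * (2 * ?n) \<le> \<alpha> * (2 * ?n)"
        using r[OF that(1)] by (intro mult_right_mono) auto
      also have "\<dots> \<le> norm (e j - (e i - r G i i))" using den[OF that] by (simp add: mult_ac)
      finally have *: "norm (r G i j) * (2 * ?n) \<le> norm (e j - (e i - r G i i))" .
      have "f G $ i $ j = r G i j / (e j - (e i - r G i i))" using that by (simp add: f_def)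
      then have "norm (f G $ i $ j) * (2 * ?n) = norm (r G i j) * (2 * ?n) / norm (e j - (e i - r G i i))"
        by (simp add: norm_divide)
      also have "\<dots> \<le> 1" using * by (simp add: divide_le_eq_1)
      finally show ?thesis .
    qed
    have n1: "?n \<ge> 1" by (simp add: Suc_leI)
    have "norm (f G $ i $ j) \<le> 1" if "G \<in> ?S" for G i j
    proof (cases "i = j")
      case False
      have "norm (f G $ i $ j) * 1 \<le> norm (f G $ i $ j) * (2 * ?n)"
        using n1 by (intro mult_left_mono) (linarith, simp)
      then show ?thesis using off[OF that False] by linarith
    qed (simp add: f_def)
    then have fS: "f \<in> ?S \<rightarrow> ?S" by auto
    have "continuous_on ?S (\<lambda>G. if i = j then 1 else r G i j / (e j - (e i - r G i i)))" for i j
    proof (cases "i = j")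
      case False
      have "\<forall>G\<in>?S. e j - (e i - r G i i) \<noteq> 0" using den0 False by blast
      then have "continuous_on ?S (\<lambda>G. r G i j / (e j - (e i - r G i i)))"
        unfolding r_def by (intro continuous_intros) auto
      then show ?thesis using False by simp
    qed simp
    then have "continuous_on ?S f"
      unfolding f_def[abs_def] by (intro continuous_on_vec_lambda)
    moreover have "?S \<noteq> {}" by (auto intro!: exI[of _ 0])
    ultimately obtain G where G: "G \<in> ?S" "f G = G"
      using brouwer[OF compact_entries_le_1 convex_entries_le_1 _ _ fS] by blast
    have diag: "G $ i $ i = 1" for i
      by (subst G(2)[symmetric]) (simp add: f_def)
    have offdiag: "G $ i $ j * (e j - (e i - r G i i)) = r G i j" if "i \<noteq> j" for i j
    proof -
      have "G $ i $ j = r G i j / (e j - (e i - r G i i))"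
        by (subst G(2)[symmetric]) (simp add: f_def that)
      then show ?thesis using den0[OF G(1) that] by simp
    qed
    let ?y = "\<lambda>i. e i - r G i i"
    have "((A + diagm ?y) ** G) $ i $ j = (G ** diagm e) $ i $ j" for i j
    proof -
      have "((A + diagm ?y) ** G) $ i $ j = (A ** G + diagm ?y ** G) $ i $ j"
        by (simp add: matrix_matrix_mult_def distrib_right sum.distrib)
      also have "\<dots> = r G i j + ?y i * G $ i $ j"
        by (simp add: diagm_mult) (simp add: r_def matrix_matrix_mult_def)
      also have "\<dots> = G $ i $ j * e j"
        using offdiag[of i j] diag by (cases "i = j") (auto simp: algebra_simps)
      finally show ?thesis by (simp add: diagm_mult)
    qed
    then have "(A + diagm ?y) ** G = G ** diagm e" by (simp add: vec_eq_iff)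
    moreover have "invertible G"
    proof (rule invertible_diagonally_dominant)
      show "norm (G $ i $ j) * (2 * ?n) \<le> 1" if "i \<noteq> j" for i j
        using off[OF G(1) that] unfolding G(2) .
    qed (rule diag)
    ultimately show ?thesis by blast
  qed
  moreover have "0 < \<alpha> * (2 * ?n + 1)" using \<alpha> by (simp add: add_pos_nonneg)
  ultimately show ?thesis by blast
qed

section \<open>Explicit moves\<close>

definition mkq :: "complex ^ 'n ^ 'n \<Rightarrow> complex ^ 'n ^ 'n \<Rightarrow> ('n \<Rightarrow> complex) \<Rightarrow> ('n \<Rightarrow> complex) \<Rightarrow>
    ('n \<Rightarrow> complex) \<Rightarrow> ('n \<Rightarrow> complex) \<Rightarrow> 'n::finite quad" where
  "mkq X Y v1 v2 w1 w2 =
    (X, Y, \<chi> i j. if j = 1 then v1 i else v2 i, \<chi> i j. if i = 1 then w1 j else w2 j)"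

lemma mkq_cases: obtains v1 v2 w1 w2 where "(X, Y, v, w) = mkq X Y v1 v2 w1 w2"
proof
  show "(X, Y, v, w) = mkq X Y (\<lambda>i. v $ i $ 1) (\<lambda>i. v $ i $ 2) (\<lambda>j. w $ 1 $ j) (\<lambda>j. w $ 2 $ j)"
    using exhaust_2 by (auto simp: mkq_def vec_eq_iff)
qed

lemma mkq_cong:
  assumes "v1 = v1'" "v2 = v2'" "w1 = w1'" "w2 = w2'"
  shows "mkq X Y v1 v2 w1 w2 = mkq X Y v1' v2' w1' w2'"
  using assms by simp

lemma to_rep_mkq:
  "to_rep (mkq X Y v1 v2 w1 w2) = (X, Y, \<chi> i j. v1 i, \<chi> i j. - v2 i, \<chi> i j. w2 j, \<chi> i j. w1 j)"
  by (simp add: to_rep_def mkq_def)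

lemma of_rep_mkq:
  "of_rep (A0, B0, X1, X2, Y1, Y2) =
    mkq A0 B0 (\<lambda>i. X1 $ i $ 1) (\<lambda>i. - X2 $ i $ 1) (\<lambda>j. Y2 $ 1 $ j) (\<lambda>j. Y1 $ 1 $ j)"
  by (simp add: of_rep_def mkq_def)

lemma level_mkq:
  "mkq X Y v1 v2 w1 w2 \<in> level \<tau> \<longleftrightarrow>
    (\<forall>i j. (X ** Y) $ i $ j - (Y ** X) $ i $ j + (v1 i * w1 j + v2 i * w2 j) = (if i = j then \<tau> else 0))"
  by (simp add: level_def moment_def mkq_def vec_eq_iff mat_def)
    (simp add: matrix_matrix_mult_def UNIV_2)

lemma get_uminus: "get11 (- M) = - get11 M" "get12 (- N) = - get12 N" "get21 (- L) = - get21 L"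
  by (simp_all add: get11_def get12_def get21_def vec_eq_iff)

lemma get_add: "get11 (M + M') = get11 M + get11 M'" "get12 (M + M') = get12 M + get12 M'"
  "get21 (M + M') = get21 M + get21 M'"
  by (simp_all add: get11_def get12_def get21_def vec_eq_iff)

lemma quad_act_F:
  "quad_act (arrow_subst F_gen) (mkq X Y v1 v2 w1 w2) =
    mkq (- Y) X v2 (\<lambda>i. - v1 i) w2 (\<lambda>j. - w1 j)"
  unfolding quad_act_def rep_act_def F_hom(3) F_gen.simps alg_hom_toD[OF eval_at_hom] eval_at_arr
    to_rep_mkq arrow_mat.simps get_uminus get_block of_rep_mkq
  by (intro mkq_cong) (simp_all add: fun_eq_iff)

text \<open>Because \<open>tri_corr 0\<close> vanishes, a constant P changes neither a nor its
  opposite, so X and Y may be arbitrary. This permits its use after F, when - Y stands in the first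
  place.\<close>

lemma quad_act_tri_const:
  "quad_act (tri [:c:] 0) (mkq X Y v1 v2 w1 w2) =
    mkq X Y v1 (\<lambda>i. v2 i - c * v1 i) (\<lambda>j. w1 j + c * w2 j) w2"
  unfolding quad_act_def rep_act_def tri_hom(3) tri_gen.simps lin_const lin_0 power_0 mult_1_left
    mult_1_right tri_corr.simps palg.scale_zero_right add_0_right
    alg_hom_toD[OF eval_at_hom] eval_at_arr to_rep_mkq arrow_mat.simps get_add get_block of_rep_mkq
  by (intro mkq_cong)
    (simp_all add: mscale_def block12_def block21_def get12_def get21_def fun_eq_iff)

lemma block_mult:
  "block11 A ** block11 A' = block11 (A ** A')" "block11 A ** block12 B = block12 (A ** B)"
  "block21 C ** block11 A = block21 (C ** A)"
  by (simp_all add: block_simps cong: if_cong)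

lemma eval_powers:
  assumes "p = (diagm d, Y, \<chi> i j. v1 i, X2, \<chi> i j. w2 j, Y2)"
  shows "eval_at p (arr ar_a ^ k * arr ar_x) = block12 (\<chi> i j. d i ^ k * v1 i)"
    "eval_at p (arr ar_y * arr ar_a ^ k) = block21 (\<chi> i j. d j ^ k * w2 j)"
    "eval_at p (idem V1 * arr ar_a ^ k) = block11 (diagm (\<lambda>i. d i ^ k))"
proof -
  show "eval_at p (arr ar_a ^ k * arr ar_x) = block12 (\<chi> i j. d i ^ k * v1 i)"
  proof (induction k)
    case (Suc k)
    have "eval_at p (arr ar_a ^ Suc k * arr ar_x) = block11 (diagm d) ** block12 (\<chi> i j. d i ^ k * v1 i)"
      unfolding power_Suc mult.assoc alg_hom_toD(2)[OF eval_at_hom, of p "arr ar_a"] Suc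
      by (simp only: eval_at_arr assms arrow_mat.simps)
    also have "\<dots> = block12 (\<chi> i j. d i ^ Suc k * v1 i)"
      unfolding block_mult by (rule arg_cong[of _ _ block12]) (simp add: vec_eq_iff diagm_mult)
    finally show ?case .
  qed (simp add: eval_at_arr assms del: tgt.simps)
  show "eval_at p (arr ar_y * arr ar_a ^ k) = block21 (\<chi> i j. d j ^ k * w2 j)"
  proof (induction k)
    case (Suc k)
    have "eval_at p (arr ar_y * arr ar_a ^ Suc k) = block21 (\<chi> i j. d j ^ k * w2 j) ** block11 (diagm d)"
      unfolding power_Suc2 mult.assoc[symmetric] alg_hom_toD(2)[OF eval_at_hom, of p _ "arr ar_a"] Suc
      by (simp only: eval_at_arr assms arrow_mat.simps)
    also have "\<dots> = block21 (\<chi> i j. d j ^ Suc k * w2 j)"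
      unfolding block_mult by (rule arg_cong[of _ _ block21]) (simp add: vec_eq_iff diagm_mult)
    finally show ?case .
  qed (simp add: eval_at_arr assms del: tgt.simps)
  show "eval_at p (idem V1 * arr ar_a ^ k) = block11 (diagm (\<lambda>i. d i ^ k))"
  proof (induction k)
    case 0
    show ?case by (simp add: mat_def diagm_def)
  next
    case (Suc k)
    have "eval_at p (idem V1 * arr ar_a ^ Suc k) = block11 (diagm (\<lambda>i. d i ^ k)) ** block11 (diagm d)"
      unfolding power_Suc2 mult.assoc[symmetric] alg_hom_toD(2)[OF eval_at_hom, of p _ "arr ar_a"] Suc
      by (simp only: eval_at_arr assms arrow_mat.simps)
    also have "\<dots> = block11 (diagm (\<lambda>i. d i ^ Suc k))"
      unfolding block_mult
      by (rule arg_cong[of _ _ block11]) (simp add: vec_eq_iff diagm_mult, simp add: diagm_def)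
    finally show ?case .
  qed
qed

lemma eval_lin: "eval_at p (lin t P) = (\<Sum>k\<le>degree P. mscale (coeff P k) (eval_at p (t k)))"
  unfolding lin_def alg_hom_to_sum[OF eval_at_hom] alg_hom_toD[OF eval_at_hom] ..

lemma eval_lin_powers:
  assumes "p = (diagm d, Y, \<chi> i j. v1 i, X2, \<chi> i j. w2 j, Y2)"
  shows "get12 (eval_at p (lin (\<lambda>k. arr ar_a ^ k * arr ar_x) P)) = (\<chi> i j. poly P (d i) * v1 i)"
    "get21 (eval_at p (lin (\<lambda>k. arr ar_y * arr ar_a ^ k) P)) = (\<chi> i j. poly P (d j) * w2 j)"
    "get11 (eval_at p (lin (\<lambda>k. idem V1 * arr ar_a ^ k) P)) = diagm (\<lambda>i. poly P (d i))"
  unfolding eval_lin eval_powers[OF assms]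
  by (simp_all add: vec_eq_iff get12_def get21_def get11_def block12_def block21_def block11_def
      mscale_def poly_altdef sum_distrib_right mult.assoc diagm_def)

text \<open>\<open>Y'\<close> stays unspecified: on the level set with distinct d the moment
  equation determines its off-diagonal part, and a later \<open>tri 0 Q\<close> corrects its
  diagonal.\<close>

lemma quad_act_tri_diag:
  "\<exists>Y'. quad_act (tri P 0) (mkq (diagm d) Y v1 v2 w1 w2) =
    mkq (diagm d) Y' v1 (\<lambda>i. v2 i - poly P (d i) * v1 i) (\<lambda>j. w1 j + poly P (d j) * w2 j) w2"
  unfolding quad_act_def rep_act_def tri_hom(3) tri_gen.simps lin_0 add_0_right
    alg_hom_toD(1)[OF eval_at_hom] eval_at_arr to_rep_mkq arrow_mat.simps get_add get_block of_rep_mkq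
    eval_lin_powers[OF refl]
  by (rule exI, rule mkq_cong) auto

lemma quad_act_tri_diag_const:
  "quad_act (tri 0 Q) (mkq (diagm d) Y v1 v2 w1 w2) =
    mkq (diagm d) (Y + diagm (\<lambda>i. poly Q (d i))) v1 v2 w1 w2"
  unfolding quad_act_def rep_act_def tri_hom(3) tri_gen.simps lin_0 add_0_right
    alg_hom_toD(1)[OF eval_at_hom] eval_at_arr to_rep_mkq arrow_mat.simps get_add get_block of_rep_mkq
    eval_lin_powers[OF refl]
  by (intro mkq_cong) (simp_all add: fun_eq_iff)

lemma interpolation:
  fixes d c :: "'n::finite \<Rightarrow> complex"
  assumes "inj d"
  shows "\<exists>P. \<forall>i. poly P (d i) = c i"
proof -
  have "\<exists>P. \<forall>i\<in>S. poly P (d i) = c i" if "finite S" for S :: "'n set"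
    using that
  proof (induction S)
    case (insert a S)
    then obtain P where P: "\<forall>i\<in>S. poly P (d i) = c i" by blast
    let ?R = "\<Prod>j\<in>S. [:- d j, 1:]"
    have R: "poly ?R (d i) = 0 \<longleftrightarrow> i \<in> S" for i
      using insert(1) assms by (auto simp: poly_prod inj_eq)
    let ?Q = "P + smult ((c a - poly P (d a)) / poly ?R (d a)) ?R"
    have "poly ?R (d a) \<noteq> 0" using R insert(2) by blast
    then have "poly ?Q (d a) = c a" by simp
    moreover have "poly ?Q (d i) = c i" if "i \<in> S" for i
    proof -
      have "poly ?R (d i) = 0" using R that by blast
      then show ?thesis using P that by simp
    qed
    ultimately show ?case by blast
  qed simp
  from this[of UNIV] show ?thesis by simp
qed

section \<open>Unipotent moves on the columns of v and rows of w\<close>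

lemma conn_const:
  "conn (mkq X Y v1 v2 w1 w2) (mkq X Y v1 (\<lambda>i. v2 i - c * v1 i) (\<lambda>j. w1 j + c * w2 j) w2)"
  using conn_tri[of "mkq X Y v1 v2 w1 w2" "[:c:]" 0] by (simp only: quad_act_tri_const)

lemma conn_F_mkq:
  "conn (mkq X Y v1 v2 w1 w2) (mkq (- Y) X v2 (\<lambda>i. - v1 i) w2 (\<lambda>j. - w1 j))"
  using conn_F[of "mkq X Y v1 v2 w1 w2"] by (simp only: quad_act_F)

text \<open>Conjugating \<open>conn_const\<close> by F exchanges the roles of the two columns, and F
  restores X and Y on the way back.\<close>

lemma conn_const':
  "conn (mkq X Y v1 v2 w1 w2) (mkq X Y (\<lambda>i. v1 i + c * v2 i) v2 w1 (\<lambda>j. w2 j - c * w1 j))"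
proof -
  have "conn (mkq X Y v1 v2 w1 w2) (mkq (- Y) X v2 (\<lambda>i. - v1 i) w2 (\<lambda>j. - w1 j))"
    by (rule conn_F_mkq)
  also have "conn \<dots> (mkq (- Y) X v2 (\<lambda>i. - v1 i - c * v2 i) (\<lambda>j. w2 j + c * - w1 j) (\<lambda>j. - w1 j))"
    by (rule conn_const)
  also have "\<dots> = mkq (- Y) X v2 (\<lambda>i. - (v1 i + c * v2 i)) (\<lambda>j. w2 j - c * w1 j) (\<lambda>j. - w1 j)"
    by simp
  also have "conn \<dots> (mkq X Y (\<lambda>i. v1 i + c * v2 i) v2 w1 (\<lambda>j. w2 j - c * w1 j))"
    by (rule conn_sym[OF conn_F_mkq])
  finally show ?thesis .
qed

text \<open>The Weyl element of SL_2 is a product of three elementary unipotents, alternately of the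
  two kinds, all with parameter -1. Being constant, they leave X and Y in place, unlike F.\<close>

lemma conn_rotate:
  "conn (mkq X Y v1 v2 w1 w2) (mkq X Y (\<lambda>i. - v2 i) v1 (\<lambda>j. - w2 j) w1)"
proof -
  have "conn (mkq X Y v1 v2 w1 w2) (mkq X Y v1 (\<lambda>i. v2 i - -1 * v1 i) (\<lambda>j. w1 j + -1 * w2 j) w2)"
    by (rule conn_const)
  also have "conn \<dots> (mkq X Y (\<lambda>i. v1 i + -1 * (v2 i - -1 * v1 i)) (\<lambda>i. v2 i - -1 * v1 i)
      (\<lambda>j. w1 j + -1 * w2 j) (\<lambda>j. w2 j - -1 * (w1 j + -1 * w2 j)))"
    by (rule conn_const')
  also have "\<dots> = mkq X Y (\<lambda>i. - v2 i) (\<lambda>i. v1 i + v2 i) (\<lambda>j. w1 j - w2 j) w1"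
    by (simp add: add.commute)
  also have "conn \<dots> (mkq X Y (\<lambda>i. - v2 i) (\<lambda>i. v1 i + v2 i - -1 * - v2 i)
      (\<lambda>j. w1 j - w2 j + -1 * w1 j) w1)"
    by (rule conn_const)
  finally show ?thesis by simp
qed

lemma conn_upper:
  assumes "inj d"
  shows "\<exists>Y'. conn (mkq (diagm d) Y v1 v2 w1 w2)
    (mkq (diagm d) Y' v1 (\<lambda>i. v2 i - c i * v1 i) (\<lambda>j. w1 j + c j * w2 j) w2)"
proof -
  obtain P where P: "\<And>i. poly P (d i) = c i" using interpolation[OF assms] by blast
  obtain Y' where "quad_act (tri P 0) (mkq (diagm d) Y v1 v2 w1 w2) =
      mkq (diagm d) Y' v1 (\<lambda>i. v2 i - c i * v1 i) (\<lambda>j. w1 j + c j * w2 j) w2"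
    using quad_act_tri_diag[of P d Y v1 v2 w1 w2] unfolding P by blast
  then show ?thesis using conn_tri[of "mkq (diagm d) Y v1 v2 w1 w2" P 0] by auto
qed

text \<open>Obtained from \<open>conn_upper\<close> by conjugation with the rotation. Conjugation
  with F would not do: it would put - Y, in general not diagonal, where the diagonal matrix has to
  be.\<close>

lemma conn_lower:
  assumes "inj d"
  shows "\<exists>Y'. conn (mkq (diagm d) Y v1 v2 w1 w2)
    (mkq (diagm d) Y' (\<lambda>i. v1 i + c i * v2 i) v2 w1 (\<lambda>j. w2 j - c j * w1 j))"
proof -
  obtain Y' where Y': "conn (mkq (diagm d) Y (\<lambda>i. - v2 i) v1 (\<lambda>j. - w2 j) w1)
    (mkq (diagm d) Y' (\<lambda>i. - v2 i) (\<lambda>i. v1 i - c i * - v2 i) (\<lambda>j. - w2 j + c j * w1 j) w1)"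
    using conn_upper[OF assms] by blast
  have "conn (mkq (diagm d) Y v1 v2 w1 w2) (mkq (diagm d) Y (\<lambda>i. - v2 i) v1 (\<lambda>j. - w2 j) w1)"
    by (rule conn_rotate)
  also note Y'
  also have "mkq (diagm d) Y' (\<lambda>i. - v2 i) (\<lambda>i. v1 i - c i * - v2 i) (\<lambda>j. - w2 j + c j * w1 j) w1 =
      mkq (diagm d) Y' (\<lambda>i. - v2 i) (\<lambda>i. v1 i + c i * v2 i) (\<lambda>j. - (w2 j - c j * w1 j)) w1"
    by simp
  also have "conn \<dots> (mkq (diagm d) Y' (\<lambda>i. v1 i + c i * v2 i) v2 w1 (\<lambda>j. w2 j - c j * w1 j))"
    by (rule conn_sym[OF conn_rotate])
  finally show ?thesis by blast
qed

lemma conn_diag_shift: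
  assumes "inj d"
  shows "conn (mkq (diagm d) Y v1 v2 w1 w2) (mkq (diagm d) (Y + diagm c) v1 v2 w1 w2)"
proof -
  obtain Q where "\<And>i. poly Q (d i) = c i" using interpolation[OF assms] by blast
  then show ?thesis using conn_tri[of "mkq (diagm d) Y v1 v2 w1 w2" 0 Q]
    by (simp add: quad_act_tri_diag_const)
qed

lemma gl_act_level:
  assumes g: "invertible g" and q: "q \<in> level \<tau>"
  shows "gl_act g q \<in> level \<tau>"
proof -
  have "moment (gl_act g q) = g ** moment q ** matrix_inv g"
    by (simp add: moment_eval to_rep_gl_act eval_at_rep_gl[OF g] gblock_mult)
  also have "\<dots> = g ** mat \<tau> ** matrix_inv g" using q by (simp add: level_def)
  also have "g ** mat \<tau> = mat \<tau> ** g"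
    by (simp add: vec_eq_iff matrix_matrix_mult_def mat_def mult.commute
        if_distrib[where f = "\<lambda>x. x * _"] if_distrib[where f = "\<lambda>x. _ * x"] cong: if_cong)
  finally show ?thesis using g by (simp add: level_def matrix_mul_assoc[symmetric] matrix_inv)
qed

text \<open>Every move fixes c and base change fixes \<tau> I. This recovers the moment equation at
  the end of a chain of moves whose effect on Y was not computed.\<close>

lemma conn_level:
  assumes "conn q q'" "q \<in> level \<tau>"
  shows "q' \<in> level \<tau>"
proof -
  obtain \<phi> where \<phi>: "\<phi> \<in> carrier TAut_c" "PT_act (cls \<phi>) (orb q) = orb q'"
    using assms(1) trans_group_carrier by (auto simp: conn_def)
  have "q' \<in> orb q'" using matrix_inv_eqI(1)[of "mat 1" "mat 1"] gl_act_1[of q']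
    by (auto simp: orb_def intro!: exI[of _ "mat 1"])
  then have "q' \<in> orb (quad_act \<phi> q)"
    using \<phi>(2) unfolding PT_act_cls[OF \<phi>(1)] by simp
  then obtain g where g: "invertible g" "q' = gl_act g (quad_act \<phi> q)"
    by (auto simp: orb_def)
  have "quad_act \<phi> q \<in> level \<tau>"
    using moment_quad_act[OF TAut_c_Aut_c[OF \<phi>(1)], of q] assms(2) by (simp add: level_def)
  then show ?thesis using g gl_act_level by blast
qed

section \<open>Normal form and transitivity\<close>

text \<open>The off-diagonal part of the rank one Calogero--Moser matrix.\<close>

definition cm_mat :: "complex \<Rightarrow> ('n \<Rightarrow> complex) \<Rightarrow> complex ^ 'n ^ 'n::finite" where
  "cm_mat \<tau> d = (\<chi> i j. if i = j then 0 else - \<tau> / (d i - d j))"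

definition cm_point :: "complex \<Rightarrow> ('n \<Rightarrow> complex) \<Rightarrow> ('n \<Rightarrow> complex) \<Rightarrow> 'n::finite quad" where
  "cm_point \<tau> d y = mkq (diagm d) (cm_mat \<tau> d + diagm y) (\<lambda>_. 1) (\<lambda>_. 0) (\<lambda>_. \<tau>) (\<lambda>_. 0)"

text \<open>For i = j this is v_i w_i = \<tau>; for i \<noteq> j and d i \<noteq> d j it determines
  Y_ij from d, v, w.\<close>

lemma level_diag:
  assumes "mkq (diagm d) Y v1 v2 w1 w2 \<in> level \<tau>"
  shows "(d i - d j) * Y $ i $ j + (v1 i * w1 j + v2 i * w2 j) = (if i = j then \<tau> else 0)"
proof -
  have "d i * Y $ i $ j - Y $ i $ j * d j + (v1 i * w1 j + v2 i * w2 j) = (if i = j then \<tau> else 0)"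
    using assms unfolding level_mkq diagm_mult by blast
  then show ?thesis by (simp add: algebra_simps)
qed

lemma conn_cm_point:
  fixes d :: "'n::finite \<Rightarrow> complex"
  assumes \<tau>: "\<tau> \<noteq> 0" and d: "inj d" and level: "mkq (diagm d) Y v1 v2 w1 w2 \<in> level \<tau>"
  shows "conn (mkq (diagm d) Y v1 v2 w1 w2) (cm_point \<tau> d y)"
proof -
  define c where "c i = (if v1 i = 0 then 1 else 0 :: complex)" for i
  define a where "a i = v1 i + c i * v2 i" for i
  have vw: "v1 i * w1 i + v2 i * w2 i = \<tau>" for i
    using level_diag[OF level, of i i] by simp
  have a: "a i \<noteq> 0" for i
    using vw[of i] \<tau> by (auto simp: a_def c_def)
  obtain Y1 where 1: "conn (mkq (diagm d) Y v1 v2 w1 w2) (mkq (diagm d) Y1 a v2 w1 (\<lambda>j. w2 j - c j * w1 j))"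
    using conn_lower[OF d, of Y v1 v2 w1 w2 c] unfolding a_def by blast
  define b where "b j = w2 j - c j * w1 j" for j
  \<comment> \<open>The multiplier v2 i / a i clears the second column of v.\<close>
  obtain Y2 where 2: "conn (mkq (diagm d) Y1 a v2 w1 b)
      (mkq (diagm d) Y2 a (\<lambda>i. v2 i - v2 i / a i * a i) (\<lambda>j. w1 j + v2 j / a j * b j) b)"
    using conn_upper[OF d, of Y1 a v2 w1 b "\<lambda>i. v2 i / a i"] by blast
  define w where "w j = w1 j + v2 j / a j * b j" for j
  have "conn (mkq (diagm d) Y v1 v2 w1 w2) (mkq (diagm d) Y2 a (\<lambda>_. 0) w b)"
    using conn_trans[OF 1[folded b_def] 2] a by (simp add: w_def[abs_def])
  \<comment> \<open>With the second column gone, the diagonal moment equation at the moved point no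
    longer involves b.\<close>
  moreover have aw: "a i * w i = \<tau>" for i
    using level_diag[OF conn_level[OF calculation level], of i i] by simp
  then have w: "w i \<noteq> 0" for i using \<tau> by (metis mult_zero_right)
  \<comment> \<open>The second row of w is cleared; the first column of v is kept, since the second
    is already zero.\<close>
  moreover obtain Y3 where "conn (mkq (diagm d) Y2 a (\<lambda>_. 0) w b)
      (mkq (diagm d) Y3 (\<lambda>i. a i + b i / w i * 0) (\<lambda>_. 0) w (\<lambda>j. b j - b j / w j * w j))"
    using conn_lower[OF d, of Y2 a "\<lambda>_. 0" w b "\<lambda>i. b i / w i"] by blast
  ultimately have 3: "conn (mkq (diagm d) Y v1 v2 w1 w2) (mkq (diagm d) Y3 a (\<lambda>_. 0) w (\<lambda>_. 0))"
    using conn_trans by fastforce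
  \<comment> \<open>Conjugation by diag(1 / a_i) commutes with diag d, turns the column a into ones
    and the row w into a_i w_i = \<tau>.\<close>
  let ?g = "diagm (\<lambda>i. 1 / a i)"
  have "?g ** diagm a = mat 1"
    using a by (simp add: vec_eq_iff diagm_mult) (simp add: diagm_def mat_def)
  note g = matrix_inv_eqI[OF this]
  have "?g ** diagm d ** diagm a = diagm d"
    using a by (simp add: vec_eq_iff diagm_mult) (simp add: diagm_def)
  moreover have "?g ** (\<chi> i j. if j = 1 then a i else 0) = (\<chi> i j. if j = 1 then 1 else 0 :: complex ^ 2 ^ 'n)"
    using a by (simp add: vec_eq_iff diagm_mult)
  moreover have "(\<chi> i j. if i = 1 then w j else 0 :: complex ^ 'n ^ 2) ** diagm a = (\<chi> i j. if i = 1 then \<tau> else 0)"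
    using aw by (simp add: vec_eq_iff diagm_mult mult.commute)
  ultimately have "gl_act ?g (mkq (diagm d) Y3 a (\<lambda>_. 0) w (\<lambda>_. 0)) =
      mkq (diagm d) (?g ** Y3 ** diagm a) (\<lambda>_. 1) (\<lambda>_. 0) (\<lambda>_. \<tau>) (\<lambda>_. 0)"
    by (simp add: gl_act_def mkq_def g)
  with conn_gl[OF g(1)] have "conn (mkq (diagm d) Y3 a (\<lambda>_. 0) w (\<lambda>_. 0))
      (mkq (diagm d) (?g ** Y3 ** diagm a) (\<lambda>_. 1) (\<lambda>_. 0) (\<lambda>_. \<tau>) (\<lambda>_. 0))"
    by metis
  from conn_trans[OF 3 this] obtain Y4 where
    4: "conn (mkq (diagm d) Y v1 v2 w1 w2) (mkq (diagm d) Y4 (\<lambda>_. 1) (\<lambda>_. 0) (\<lambda>_. \<tau>) (\<lambda>_. 0))"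
    by blast
  have "Y4 $ i $ j = - \<tau> / (d i - d j)" if "i \<noteq> j" for i j
  proof -
    have "d i - d j \<noteq> 0" using d that by (simp add: inj_eq)
    moreover have "(d i - d j) * Y4 $ i $ j = - \<tau>"
      using level_diag[OF conn_level[OF 4 level], of i j] that by (simp add: eq_neg_iff_add_eq_0)
    ultimately show ?thesis by (simp add: field_simps)
  qed
  \<comment> \<open>The moment equation has fixed Y4 off the diagonal; the shift replaces its
    diagonal by y.\<close>
  then have "Y4 + diagm (\<lambda>i. y i - Y4 $ i $ i) = cm_mat \<tau> d + diagm y"
    by (simp add: vec_eq_iff diagm_def cm_mat_def)
  then have "conn (mkq (diagm d) Y4 (\<lambda>_. 1) (\<lambda>_. 0) (\<lambda>_. \<tau>) (\<lambda>_. 0)) (cm_point \<tau> d y)"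
    using conn_diag_shift[OF d] unfolding cm_point_def by metis
  with 4 show ?thesis by (rule conn_trans)
qed

section \<open>From regular semisimple points to a common point\<close>

lemma conn_regular_X:
  fixes X :: "complex ^ 'n::finite ^ 'n"
  assumes \<tau>: "\<tau> \<noteq> 0" and d: "inj d" and g: "invertible g" "g ** X ** matrix_inv g = diagm d"
    and level: "(X, Y, v, w) \<in> level \<tau>"
  shows "conn (X, Y, v, w) (cm_point \<tau> d y)"
proof -
  obtain v1 v2 w1 w2 where e: "gl_act g (X, Y, v, w) = mkq (diagm d) (g ** Y ** matrix_inv g) v1 v2 w1 w2"
    unfolding gl_act_def prod.case g(2) using mkq_cases by metis
  show ?thesis
    using conn_trans[OF conn_gl[OF g(1), of "(X, Y, v, w)", unfolded e]
        conn_cm_point[OF \<tau> d gl_act_level[OF g(1) level, unfolded e]]] .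
qed

lemma cm_point_level:
  assumes "inj d"
  shows "cm_point \<tau> d y \<in> level \<tau>"
  unfolding cm_point_def level_mkq diagm_mult
proof (intro allI)
  fix i j
  let ?Y = "(cm_mat \<tau> d + diagm y) $ i $ j"
  have "(d i - d j) * ?Y = - \<tau>" if "i \<noteq> j"
    using assms that by (simp add: cm_mat_def diagm_def inj_eq)
  then show "d i * ?Y - ?Y * d j + (1 * \<tau> + 0 * 0) = (if i = j then \<tau> else 0)"
    by (cases "i = j") (simp_all add: algebra_simps)
qed

text \<open>If X is not regular semisimple, F moves - Y into the first place, at the price of the
  spectrum - d. One d serves all diagonals y, which leaves y free for
  \<open>cm_point_connect\<close>.\<close>

lemma conn_R_var:
  fixes \<xi> :: "'n::finite quad set"
  assumes "\<tau> \<noteq> 0" "\<xi> \<in> R_var \<tau>"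
  shows "\<exists>q d. \<xi> = orb q \<and> inj d \<and> (\<forall>y. conn q (cm_point \<tau> d y))"
proof -
  obtain X Y v w where q: "(X, Y, v, w) \<in> \<xi>" and rs: "regular_semisimple X \<or> regular_semisimple Y"
    and "\<xi> \<in> C_var \<tau>"
    using assms(2) by (auto simp: R_var_def)
  then obtain q0 g where "q0 \<in> level \<tau>" "\<xi> = orb q0" "invertible g" "(X, Y, v, w) = gl_act g q0"
    by (auto simp: C_var_orb) (auto simp: orb_def)
  then have orb: "\<xi> = orb (X, Y, v, w)" and level: "(X, Y, v, w) \<in> level \<tau>"
    using orb_gl_act gl_act_level by metis+
  have "\<exists>d. inj d \<and> (\<forall>y. conn (X, Y, v, w) (cm_point \<tau> d y))"
  proof (cases "regular_semisimple X")
    case True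
    then obtain g :: "complex ^ 'n ^ 'n" and d
      where "invertible g" "inj d" "g ** X ** matrix_inv g = diagm d"
      unfolding regular_semisimple_def diagm_def[symmetric] by blast
    then show ?thesis using conn_regular_X[OF assms(1) _ _ _ level] by blast
  next
    case False
    then obtain g :: "complex ^ 'n ^ 'n" and d
      where g: "invertible g" "inj d" "g ** Y ** matrix_inv g = diagm d"
      using rs unfolding regular_semisimple_def diagm_def[symmetric] by blast
    obtain v1 v2 w1 w2 where m: "(X, Y, v, w) = mkq X Y v1 v2 w1 w2" by (rule mkq_cases)
    let ?q = "mkq (- Y) X v2 (\<lambda>i. - v1 i) w2 (\<lambda>j. - w1 j)"
    have F: "conn (X, Y, v, w) ?q" unfolding m by (rule conn_F_mkq)
    have "g ** (- Y) ** matrix_inv g = - diagm d"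
      unfolding g(3)[symmetric] by (simp only: matrix_mult_uminus)
    also have "\<dots> = diagm (\<lambda>i. - d i)" by (simp add: diagm_def vec_eq_iff)
    finally have e: "g ** (- Y) ** matrix_inv g = diagm (\<lambda>i. - d i)" .
    have i: "inj (\<lambda>i. - d i)" using g(2) by (simp add: inj_def)
    have "conn ?q (cm_point \<tau> (\<lambda>i. - d i) y)" for y
      using conn_regular_X[OF assms(1) i g(1) e] conn_level[OF F level] unfolding mkq_def by blast
    then show ?thesis using i conn_trans[OF F] by blast
  qed
  with orb show ?thesis by blast
qed

text \<open>M depends only on \<tau> and d, and the target only on \<tau> and e; so points with
  different d can be sent to the same target.\<close>

lemma cm_point_connect:
  fixes d :: "'n::finite \<Rightarrow> complex"
  assumes \<tau>: "\<tau> \<noteq> 0" and d: "inj d"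
  shows "\<exists>M>0. \<forall>e. (\<forall>i j. i \<noteq> j \<longrightarrow> M \<le> norm (e i - e j)) \<longrightarrow>
    (\<exists>y. conn (cm_point \<tau> d y) (cm_point \<tau> (\<lambda>i. - e i) (\<lambda>_. 0)))"
proof -
  obtain M where M: "M > 0" "\<And>e :: 'n \<Rightarrow> complex. (\<forall>i j. i \<noteq> j \<longrightarrow> M \<le> norm (e i - e j)) \<Longrightarrow>
      \<exists>y G. invertible G \<and> (cm_mat \<tau> d + diagm y) ** G = G ** diagm e"
    using diagonal_perturbation_spectrum[of "cm_mat \<tau> d"] by blast
  have "\<exists>y. conn (cm_point \<tau> d y) (cm_point \<tau> (\<lambda>i. - e i) (\<lambda>_. 0))"
    if e: "\<forall>i j. i \<noteq> j \<longrightarrow> M \<le> norm (e i - e j)" for e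
  proof -
    obtain y G where G: "invertible G" "(cm_mat \<tau> d + diagm y) ** G = G ** diagm e"
      using M(2)[OF e] by blast
    let ?Y = "cm_mat \<tau> d + diagm y"
    \<comment> \<open>The image under F: its first matrix has spectrum - e, whence the sign in the
      target.\<close>
    let ?q = "mkq (- ?Y) (diagm d) (\<lambda>_. 0) (\<lambda>_. - 1) (\<lambda>_. 0) (\<lambda>_. - \<tau>)"
    have F: "conn (cm_point \<tau> d y) ?q"
      using conn_F_mkq[of "diagm d" ?Y "\<lambda>_. 1" "\<lambda>_. 0" "\<lambda>_. \<tau>" "\<lambda>_. 0"] by (simp add: cm_point_def)
    have e': "inj (\<lambda>i. - e i)"
    proof (rule injI, rule ccontr)
      fix i j assume "- e i = - e j" "i \<noteq> j"
      then show False using e[rule_format, of i j] M(1) by simp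
    qed
    \<comment> \<open>The columns of G are eigenvectors, so the diagonalising base change is
      \<open>matrix_inv G\<close>.\<close>
    have h: "matrix_inv G ** G = mat 1" using G(1) by (rule matrix_inv)
    note inv = matrix_inv_eqI[OF h]
    have "matrix_inv G ** (- ?Y) ** G = - (matrix_inv G ** (?Y ** G))"
      by (simp only: matrix_mult_uminus matrix_mul_assoc)
    also have "\<dots> = - diagm e" unfolding G(2) by (simp add: matrix_mul_assoc h)
    also have "\<dots> = diagm (\<lambda>i. - e i)" by (simp add: diagm_def vec_eq_iff)
    finally have D: "matrix_inv G ** (- ?Y) ** matrix_inv (matrix_inv G) = diagm (\<lambda>i. - e i)"
      by (simp add: inv)
    have L: "?q \<in> level \<tau>" by (rule conn_level[OF F cm_point_level[OF d]])
    have "conn ?q (cm_point \<tau> (\<lambda>i. - e i) (\<lambda>_. 0))"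
      using conn_regular_X[OF \<tau> e' inv(1) D L[unfolded mkq_def]] unfolding mkq_def .
    with F show ?thesis using conn_trans by blast
  qed
  with M(1) show ?thesis by blast
qed

theorem theorem1:
  fixes \<tau> :: complex
  assumes "\<tau> \<noteq> 0"
  shows "\<exists>i \<in> hom Gamma_alg PTAut_c.
    \<forall>\<xi>1 \<in> R_var \<tau> :: 'n::finite quad set set. \<forall>\<xi>2 \<in> R_var \<tau>.
      \<exists>\<Phi> \<in> generate PTAut_c (i ` carrier Gamma_alg \<union> {F_class}). PT_act \<Phi> \<xi>1 = \<xi>2"
proof (rule bexI[OF _ Gamma_hom], intro ballI)
  fix \<xi>1 \<xi>2 :: "'n quad set"
  assume "\<xi>1 \<in> R_var \<tau>" "\<xi>2 \<in> R_var \<tau>"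
  then obtain q1 d1 q2 d2 where
    1: "\<xi>1 = orb q1" "inj d1" "\<And>y. conn q1 (cm_point \<tau> d1 y)" and
    2: "\<xi>2 = orb q2" "inj d2" "\<And>y. conn q2 (cm_point \<tau> d2 y)"
    using conn_R_var[OF assms] by metis
  obtain M1 where M1: "M1 > 0" "\<And>e. (\<forall>i j. i \<noteq> j \<longrightarrow> M1 \<le> norm (e i - e j)) \<Longrightarrow>
      \<exists>y. conn (cm_point \<tau> d1 y) (cm_point \<tau> (\<lambda>i. - e i) (\<lambda>_. 0))"
    using cm_point_connect[OF assms 1(2)] by blast
  obtain M2 where M2: "M2 > 0" "\<And>e. (\<forall>i j. i \<noteq> j \<longrightarrow> M2 \<le> norm (e i - e j)) \<Longrightarrow>
      \<exists>y. conn (cm_point \<tau> d2 y) (cm_point \<tau> (\<lambda>i. - e i) (\<lambda>_. 0))"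
    using cm_point_connect[OF assms 2(2)] by blast
  obtain h :: "'n \<Rightarrow> nat" where h: "inj h"
    using finite_imp_inj_to_nat_seg[of "UNIV :: 'n set"] by auto
  \<comment> \<open>Multiples of the larger bound along an injective numbering: any two of them are
    at least that bound apart.\<close>
  let ?e = "\<lambda>i. complex_of_real (max M1 M2 * real (h i))"
  have "max M1 M2 \<le> norm (?e i - ?e j)" if "i \<noteq> j" for i j
  proof -
    have "h i \<noteq> h j" using h that by (simp add: inj_eq)
    then have "1 \<le> \<bar>real (h i) - real (h j)\<bar>" by linarith
    then have "max M1 M2 * 1 \<le> max M1 M2 * \<bar>real (h i) - real (h j)\<bar>"
      using M1(1) by (intro mult_left_mono) auto
    also have "\<dots> = norm (?e i - ?e j)"
    proof -
      have "?e i - ?e j = complex_of_real (max M1 M2 * (real (h i) - real (h j)))"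
        by (simp add: algebra_simps)
      then show ?thesis using M1(1) by (simp only: norm_of_real abs_mult)
    qed
    finally show ?thesis by simp
  qed
  then have e: "\<forall>i j. i \<noteq> j \<longrightarrow> M1 \<le> norm (?e i - ?e j)" "\<forall>i j. i \<noteq> j \<longrightarrow> M2 \<le> norm (?e i - ?e j)"
    by (meson max.boundedE)+
  let ?p = "cm_point \<tau> (\<lambda>i. - ?e i) (\<lambda>_. 0)"
  have "conn q1 ?p" using M1(2)[OF e(1)] 1(3) conn_trans by blast
  moreover have "conn q2 ?p" using M2(2)[OF e(2)] 2(3) conn_trans by blast
  ultimately have "conn q1 q2" using conn_sym conn_trans by blast
  then show "\<exists>\<Phi>\<in>generate PTAut_c (Gamma_hom ` carrier Gamma_alg \<union> {F_class}). PT_act \<Phi> \<xi>1 = \<xi>2"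
    unfolding conn_def trans_group_def 1(1) 2(1) .
qed

end
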